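(* Let $\tau\in(0,\infty)$, let $\mu_1,\mu_2$ be non-negative Borel measures on $\mathbb{R}^+=[0,\infty)$ with $$M:=\mu_1([0,\tau])+\mu_2([0,\infty))\in(0,\infty),$$ and let $f\in C(\mathbb{R}^+;(0,\infty))$ be locally Lipschitz continuous and regularly varying at infinity with index $\beta$, where $\beta\in(-\infty,1)\setminus\{0\}$. Let $\psi\in C([-\tau,0];(0,\infty))$. Put $F(x)=\int_1^x \frac{du}{f(u)}$ for $x>0$. Then the unique continuous solution $x$ of $$x'(t)=\int_{[0,\tau]}\mu_1(ds)f(x(t-s))+\int_{[0,t]}\mu_2(ds)f(x(t-s)),\quad t>0;\qquad x(t)=\psi(t),\ t\in[-\tau,0],$$ obeys $$\lim_{t\to\infty}x(t)=\infty,\qquad \lim_{t\to\infty}\frac{x(t)}{F^{-1}(Mt)}=1.$$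
   Context: A measurable function $h:\mathbb{R}^+\to(0,\infty)$ is regularly varying at infinity with index $\beta\in\mathbb{R}$ (written $h\in\mathrm{RV}_\infty(\beta)$) if $\lim_{x\to\infty}h(\lambda x)/h(x)=\lambda^\beta$ for all $\lambda>0$. $F$ is strictly increasing; $F^{-1}$ is its inverse function. A solution is a continuous function on $[-\tau,\infty)$, locally absolutely continuous on $[0,\infty)$, equal to $\psi$ on $[-\tau,0]$ and satisfying the differential equation for almost every $t>0$. *)

theory Defs
  imports "HOL-Analysis.Analysis"
begin

text \<open>Functions on \<open>[0,\<infinity>)\<close> are represented by functions on \<open>real\<close>, all requirements on
  which are restricted to \<open>{0..}\<close>.\<close>

definition regularly_varying :: "(real \<Rightarrow> real) \<Rightarrow> real \<Rightarrow> bool" where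
  "regularly_varying h \<beta> \<longleftrightarrow>
     h \<in> borel_measurable (restrict_space borel {0..}) \<and>
     (\<forall>x\<ge>0. 0 < h x) \<and>
     (\<forall>l>0. ((\<lambda>x. h (l * x) / h x) \<longlongrightarrow> l powr \<beta>) at_top)"

definition locally_lipschitz_on :: "real set \<Rightarrow> (real \<Rightarrow> real) \<Rightarrow> bool" where
  "locally_lipschitz_on S f \<longleftrightarrow> (\<forall>x\<in>S. \<exists>u>0. \<exists>L. L-lipschitz_on (cball x u \<inter> S) f)"

definition absolutely_continuous_on :: "real set \<Rightarrow> (real \<Rightarrow> real) \<Rightarrow> bool" where
  "absolutely_continuous_on I x \<longleftrightarrow>
     (\<forall>\<epsilon>>0. \<exists>\<delta>>0. \<forall>(n::nat) a b.
        (\<forall>k<n. a k \<le> b k \<and> {a k..b k} \<subseteq> I) \<longrightarrow>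
        disjoint_family_on (\<lambda>k. {a k<..<b k}) {..<n} \<longrightarrow>
        (\<Sum>k<n. b k - a k) < \<delta> \<longrightarrow>
        (\<Sum>k<n. \<bar>x (b k) - x (a k)\<bar>) < \<epsilon>)"

definition locally_absolutely_continuous_on :: "real set \<Rightarrow> (real \<Rightarrow> real) \<Rightarrow> bool" where
  "locally_absolutely_continuous_on I x \<longleftrightarrow>
     (\<forall>a b. {a..b} \<subseteq> I \<longrightarrow> absolutely_continuous_on {a..b} x)"

text \<open>The requirement \<open>0 \<le> x t\<close> says that \<open>x\<close> takes values in the domain \<open>[0,\<infinity>)\<close> of the
  nonlinearity \<open>f\<close>, so that the right-hand side is meaningful.\<close>

definition is_solution ::
  "real \<Rightarrow> real measure \<Rightarrow> real measure \<Rightarrow> (real \<Rightarrow> real) \<Rightarrow> (real \<Rightarrow> real) \<Rightarrow> (real \<Rightarrow> real) \<Rightarrow> bool"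
where
  "is_solution \<tau> \<mu>\<^sub>1 \<mu>\<^sub>2 f \<psi> x \<longleftrightarrow>
     continuous_on {-\<tau>..} x \<and>
     (\<forall>t\<ge>-\<tau>. 0 \<le> x t) \<and>
     locally_absolutely_continuous_on {0..} x \<and>
     (\<forall>t\<in>{-\<tau>..0}. x t = \<psi> t) \<and>
     (AE t in lebesgue. 0 < t \<longrightarrow>
        (x has_real_derivative
           (LINT s:{0..\<tau>}|\<mu>\<^sub>1. f (x (t - s))) + (LINT s:{0..t}|\<mu>\<^sub>2. f (x (t - s)))) (at t))"

text \<open>The interval integral is oriented, so the value is negative for \<open>0 < x < 1\<close>.\<close>

definition recip_primitive :: "(real \<Rightarrow> real) \<Rightarrow> real \<Rightarrow> real" where
  "recip_primitive f x = (LBINT u=ereal 1..ereal x. 1 / f u)"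

definition recip_primitive_inv :: "(real \<Rightarrow> real) \<Rightarrow> real \<Rightarrow> real" where
  "recip_primitive_inv f = the_inv_into {0<..} (recip_primitive f)"

end

theory Submission
  imports Defs
begin

text \<open>Write \<open>I t\<close> for the integral of \<open>f (x u)\<close> over \<open>[0, t]\<close>. Integrating the equation and exchanging
  the order of integration gives, for every \<open>S \<ge> 0\<close>,
  \<open>(\<mu>\<^sub>1[0,S] + \<mu>\<^sub>2[0,S]) * I (t - S) \<le> x t \<le> C + M * I t\<close>, where \<open>\<mu>\<^sub>1\<close> is restricted to \<open>[0, \<tau>]\<close>; working with the integrated equation
  avoids any monotonicity of \<open>f\<close>. Since \<open>f u / u \<rightarrow> 0\<close> and \<open>x\<close> is
  nondecreasing, \<open>I (t - S) / I t \<rightarrow> 1\<close>, hence \<open>x\<close> is asymptotic to \<open>J = M * I\<close>. Regular variation is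
  locally uniform (a Baire category argument), so \<open>J' = M * f (x t)\<close> is asymptotic to \<open>M * f (J t)\<close> and
  \<open>F (J t)\<close> is asymptotic to \<open>M * t\<close>; as \<open>F\<close> is regularly varying with index \<open>1 - \<beta> > 0\<close>, \<open>J t\<close> is
  asymptotic to the inverse of \<open>F\<close> at \<open>M * t\<close>. Existence is by Picard iteration in an exponentially
  weighted norm.\<close>

text \<open>The two delay terms have different shapes: a fixed window that reaches into the history,
  and a window that grows with \<open>t\<close> and ignores the history. Both become convolutions of
  a cut-off \<open>f (x u)\<close> with finite measures on the line, so one pair of Fubini estimates
  serves both. The price is a right-hand side that may jump at translates of atoms, so a fixed point
  of the integral operator is shown to be differentiable only off a countable set. A competing
  solution satisfies the equation merely almost everywhere; uniqueness therefore rests on the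
  fundamental theorem of calculus for absolutely continuous functions, proved here with gauges,
  which makes every solution a fixed point. The lag \<open>S\<close> is there because
  \<open>\<mu>\<^sub>2\<close> may have unbounded support: a finite lag already captures mass as
  close to \<open>M\<close> as desired, and a finite shift does not affect the growth of
  \<open>I\<close>. The condition \<open>\<beta> < 1\<close> acts through sublinearity of
  \<open>f\<close>: it excludes blow-up in finite time, makes \<open>F\<close> unbounded, and lets
  \<open>I\<close> forget shifts.\<close>

section \<open>Regular variation\<close>

text \<open>The sets \<open>A n\<close> of those \<open>v\<close> whose increments stay below
  \<open>\<epsilon>/2\<close> from \<open>n\<close> on are closed by continuity and cover the line,
  so by Baire one of them contains a ball. Uniformity near 0 is all that is needed later, where
  ratios of arguments tend to 1.\<close>

lemma increments_uniform_near_0: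
  fixes h :: "real \<Rightarrow> real"
  assumes cont: "continuous_on UNIV h"
    and lim: "\<And>v. ((\<lambda>s. h (s + v) - h s) \<longlongrightarrow> 0) at_top"
    and "0 < \<epsilon>"
  shows "\<exists>\<delta>>0. \<exists>N. \<forall>s\<ge>N. \<forall>v. \<bar>v\<bar> < \<delta> \<longrightarrow> \<bar>h (s + v) - h s\<bar> \<le> \<epsilon>"
proof -
  define A where "A n = {v. \<forall>s\<in>{real n..}. \<bar>h (s + v) - h s\<bar> \<le> \<epsilon>/2}" for n :: nat
  have closed: "closed (A n)" for n
  proof -
    have "A n = (\<Inter>s\<in>{real n..}. {v. \<bar>h (s + v) - h s\<bar> \<le> \<epsilon>/2})"
      by (auto simp: A_def)
    moreover have "closed {v. \<bar>h (s + v) - h s\<bar> \<le> \<epsilon>/2}" for s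
      by (intro closed_Collect_le continuous_intros continuous_on_compose2[OF cont]) auto
    ultimately show ?thesis by auto
  qed
  have cover: "\<exists>n. v \<in> A n" for v
  proof -
    have "eventually (\<lambda>s. \<bar>h (s + v) - h s\<bar> < \<epsilon>/2) at_top"
      using tendstoD[OF lim[of v], of "\<epsilon>/2"] \<open>0 < \<epsilon>\<close> by (simp add: dist_real_def)
    then obtain N where N: "\<And>s. s \<ge> N \<Longrightarrow> \<bar>h (s + v) - h s\<bar> < \<epsilon>/2"
      by (auto simp: eventually_at_top_linorder)
    obtain n where "N \<le> real n" using real_arch_simple by blast
    then have "v \<in> A n" unfolding A_def using N by (auto intro!: less_imp_le)
    then show ?thesis by blast
  qed
  have "\<exists>n. interior (A n) \<noteq> {}"
  proof (rule ccontr)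
    assume *: "\<not> ?thesis"
    have "UNIV \<subseteq> closure (\<Inter>(range (\<lambda>n. - A n)))"
    proof (rule Baire)
      fix T assume "T \<in> range (\<lambda>n. - A n)"
      then show "openin (top_of_set UNIV) T \<and> UNIV \<subseteq> closure T"
        using closed * by (auto simp: closure_complement)
    qed auto
    moreover have "\<Inter>(range (\<lambda>n. - A n)) = {}" using cover by auto
    ultimately show False by simp
  qed
  then obtain n c where "c \<in> interior (A n)" by auto
  then obtain r where r: "r > 0" "ball c r \<subseteq> A n" by (auto simp: mem_interior)
  \<comment> \<open>The ball around \<open>c\<close> is moved to 0 by comparing \<open>h s\<close>
    and \<open>h (s + v)\<close> with \<open>h (s - c)\<close>: these are the increments by
    \<open>c\<close> and \<open>c + v\<close> from the base point \<open>s - c\<close>, which the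
    summand \<open>\<bar>c\<bar>\<close> keeps beyond \<open>n\<close>.\<close>
  have "\<bar>h (s + v) - h s\<bar> \<le> \<epsilon>" if "s \<ge> real n + \<bar>c\<bar>" "\<bar>v\<bar> < r" for s v
  proof -
    have "c \<in> A n" "c + v \<in> A n" using r that by (auto simp: dist_real_def subset_eq)
    moreover have "s - c \<ge> real n" using that by auto
    ultimately have "\<bar>h ((s - c) + c) - h (s - c)\<bar> \<le> \<epsilon>/2" "\<bar>h ((s - c) + (c + v)) - h (s - c)\<bar> \<le> \<epsilon>/2"
      unfolding A_def by blast+
    then have "\<bar>h s - h (s - c)\<bar> \<le> \<epsilon>/2" "\<bar>h (s + v) - h (s - c)\<bar> \<le> \<epsilon>/2"
      by (simp_all add: algebra_simps)
    then show ?thesis by (smt (verit) field_sum_of_halves)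
  qed
  then show ?thesis using r(1) by blast
qed

text \<open>Pointwise regular variation fixes the factor \<open>l\<close>, whereas here the ratio
  \<open>v t / u t\<close> moves. In logarithmic coordinates, after removal of the power
  \<open>\<beta>\<close>, regular variation says that increments of \<open>h\<close> tend to 0, and
  their uniformity for small shifts absorbs the moving ratio.\<close>

lemma regularly_varying_asymp_cong:
  assumes cont: "continuous_on {0..} f" and rv: "regularly_varying f \<beta>"
    and u: "filterlim u at_top G" and uv: "((\<lambda>t. v t / u t) \<longlongrightarrow> 1) G"
  shows "((\<lambda>t. f (v t) / f (u t)) \<longlongrightarrow> 1) G"
proof -
  have pos: "f x > 0" if "x \<ge> 0" for x using rv that by (auto simp: regularly_varying_def)
  define h where "h s = ln (f (exp s)) - \<beta> * s" for s
  have conth: "continuous_on UNIV h"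
    unfolding h_def
    by (intro continuous_intros continuous_on_compose2[OF cont]) (use pos in \<open>auto simp: less_imp_neq[THEN not_sym]\<close>)
  have limh: "((\<lambda>s. h (s + w) - h s) \<longlongrightarrow> 0) at_top" for w
  proof -
    have "((\<lambda>x. f (exp w * x) / f x) \<longlongrightarrow> exp w powr \<beta>) at_top"
      using rv by (auto simp: regularly_varying_def)
    from filterlim_compose[OF this exp_at_top]
    have "((\<lambda>s. ln (f (exp w * exp s) / f (exp s))) \<longlongrightarrow> ln (exp w powr \<beta>)) at_top"
      by (intro tendsto_ln) auto
    moreover have "ln (f (exp w * exp s) / f (exp s)) = h (s + w) - h s + \<beta> * w" for s
      by (simp add: h_def ln_div pos exp_add mult.commute algebra_simps less_imp_neq[THEN not_sym])
    ultimately have "((\<lambda>s. h (s + w) - h s + \<beta> * w - \<beta> * w) \<longlongrightarrow> \<beta> * w - \<beta> * w) at_top"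
      by (intro tendsto_diff tendsto_const) (simp add: ln_powr)
    then show ?thesis by simp
  qed
  have evu: "eventually (\<lambda>t. u t > 0) G"
    using u by (auto simp: filterlim_at_top_dense)
  have evr: "eventually (\<lambda>t. v t / u t > 0) G"
    using order_tendstoD(1)[OF uv, of 0] by simp
  define w where "w t = ln (v t / u t)" for t
  have w: "(w \<longlongrightarrow> 0) G" unfolding w_def using tendsto_ln[OF uv] by simp
  have lnu: "filterlim (\<lambda>t. ln (u t)) at_top G"
    by (rule filterlim_compose[OF ln_at_top u])
  have hw: "((\<lambda>t. h (ln (u t) + w t) - h (ln (u t))) \<longlongrightarrow> 0) G"
  proof (rule tendstoI)
    fix e :: real assume "e > 0"
    from increments_uniform_near_0[OF conth limh, of "e/2"] this
    obtain \<delta> N where d: "\<delta> > 0" "\<And>s v. s \<ge> N \<Longrightarrow> \<bar>v\<bar> < \<delta> \<Longrightarrow> \<bar>h (s + v) - h s\<bar> \<le> e/2" by auto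
    have "eventually (\<lambda>t. \<bar>w t\<bar> < \<delta>) G" using tendstoD[OF w d(1)] by (simp add: dist_real_def)
    moreover have "eventually (\<lambda>t. ln (u t) \<ge> N) G" using lnu by (auto simp: filterlim_at_top)
    ultimately show "eventually (\<lambda>t. dist (h (ln (u t) + w t) - h (ln (u t))) 0 < e) G"
    proof eventually_elim
      case (elim t)
      with d(2)[of "ln (u t)" "w t"] \<open>e > 0\<close> show ?case by (simp add: dist_real_def)
    qed
  qed
  have "((\<lambda>t. exp (h (ln (u t) + w t) - h (ln (u t)) + \<beta> * w t)) \<longlongrightarrow> exp (0 + \<beta> * 0)) G"
    by (intro tendsto_intros hw w)
  moreover have "eventually (\<lambda>t. exp (h (ln (u t) + w t) - h (ln (u t)) + \<beta> * w t) = f (v t) / f (u t)) G"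
    using evu evr
  proof eventually_elim
    case (elim t)
    then have vp: "v t > 0" by (simp add: zero_less_divide_iff)
    then have "ln (u t) + w t = ln (v t)" using elim by (simp add: w_def ln_div)
    then show ?case using elim vp pos[of "u t"] pos[of "v t"]
      by (simp add: h_def w_def ln_div algebra_simps exp_diff exp_add)
  qed
  ultimately show ?thesis by (auto simp: tendsto_cong)
qed

text \<open>Doubling the argument multiplies \<open>f x / x\<close> by about
  \<open>2 powr (\<beta> - 1) < 1\<close>, so it decays geometrically along dyadic scales.\<close>

lemma regularly_varying_sublinear:
  assumes cont: "continuous_on {0..} f" and rv: "regularly_varying f \<beta>" and "\<beta> < 1"
  shows "((\<lambda>x. f x / x) \<longlongrightarrow> 0) at_top"
proof -
  have pos: "f x > 0" if "x \<ge> 0" for x using rv that by (auto simp: regularly_varying_def)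
  have "(2::real) powr \<beta> < 2 powr 1" using \<open>\<beta> < 1\<close> by (intro powr_less_mono) auto
  then have "(2::real) powr \<beta> / 2 < 1" by simp
  \<comment> \<open>Any \<open>q\<close> strictly between the limiting factor and 1 works: the lower
    gap makes the doubling inequality hold eventually, the upper one gives decay.\<close>
  then obtain q where "2 powr \<beta> / 2 < q" and "q < 1" using dense by blast
  then have q: "2 powr \<beta> < 2 * q" "q < 1" by auto
  have "0 < (2::real) powr \<beta>" by simp
  with q have q0: "0 < q" by linarith
  define k where "k x = f x / x" for x
  have "((\<lambda>x. f (2 * x) / f x) \<longlongrightarrow> 2 powr \<beta>) at_top"
    using rv by (auto simp: regularly_varying_def)
  from order_tendstoD(2)[OF this q(1)] obtain X0 where
    X0: "\<And>x. x \<ge> X0 \<Longrightarrow> f (2 * x) / f x < 2 * q" by (auto simp: eventually_at_top_linorder)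
  define X where "X = max X0 1"
  have X: "X \<ge> 1" "\<And>x. x \<ge> X \<Longrightarrow> k (2 * x) \<le> q * k x"
  proof -
    show "X \<ge> 1" by (simp add: X_def)
    fix x assume "x \<ge> X"
    then have "x \<ge> X0" "x \<ge> 1" by (auto simp: X_def)
    with X0[of x] pos[of x] show "k (2 * x) \<le> q * k x" by (simp add: k_def field_simps)
  qed
  have kpos: "k x > 0" if "x > 0" for x using that pos[of x] by (simp add: k_def)
  have "compact (k ` {X..2 * X})"
    unfolding k_def using X(1)
    by (intro compact_continuous_image continuous_intros continuous_on_subset[OF cont]) auto
  then have "bdd_above (k ` {X..2 * X})" by (intro bounded_imp_bdd_above compact_imp_bounded)
  then obtain B where B: "\<And>x. x \<in> {X..2*X} \<Longrightarrow> k x \<le> B"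
    unfolding bdd_above_def by (metis imageI)
  \<comment> \<open>Since \<open>q < 1\<close>, halving the argument shows that the bound on the
    first dyadic block is inherited by every later block.\<close>
  have B1: "\<forall>x\<in>{X..2 ^ Suc m * X}. k x \<le> B" for m
  proof (induction m)
    case 0 then show ?case using B by auto
  next
    case (Suc m)
    show ?case
    proof
      fix x assume x: "x \<in> {X..2 ^ Suc (Suc m) * X}"
      show "k x \<le> B"
      proof (cases "x \<le> 2 * X")
        case True then show ?thesis using B x by auto
      next
        case False
        then have "x/2 \<in> {X..2 ^ Suc m * X}" using x by auto
        then have "k (x/2) \<le> B" "k (2 * (x/2)) \<le> q * k (x/2)" using Suc X(2)[of "x/2"] by auto
        moreover have "q * k (x/2) \<le> 1 * k (x/2)"
          using q kpos[of "x/2"] False X(1) by (intro mult_right_mono) auto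
        ultimately show ?thesis by simp
      qed
    qed
  qed
  have B2: "k x \<le> B" if "x \<ge> X" for x
  proof -
    obtain m where "x < 2 ^ m" using real_arch_pow[of 2 x] by auto
    moreover have "(2::real) ^ m * 1 \<le> 2 ^ Suc m * X" using X(1) by (intro mult_mono) auto
    ultimately have "x \<le> 2 ^ Suc m * X" by linarith
    then show ?thesis using B1[of m] that by auto
  qed
  have B3: "\<forall>x\<ge>2 ^ n * X. k x \<le> q ^ n * B" for n
  proof (induction n)
    case 0 then show ?case using B2 by auto
  next
    case (Suc n)
    show ?case
    proof safe
      fix x assume x: "x \<ge> 2 ^ Suc n * X"
      then have 1: "x/2 \<ge> 2 ^ n * X" by auto
      moreover have "2 ^ n * X \<ge> 1 * X" using X(1) by (intro mult_right_mono) auto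
      ultimately have "k (2 * (x/2)) \<le> q * k (x/2)" using X(2)[of "x/2"] by auto
      also have "\<dots> \<le> q * (q ^ n * B)" using 1 Suc q0 by (intro mult_left_mono) auto
      finally show "k x \<le> q ^ Suc n * B" by (simp add: mult_ac)
    qed
  qed
  show ?thesis
  proof (rule tendstoI)
    fix e :: real assume "e > 0"
    have "(\<lambda>n. q ^ n * B) \<longlonglongrightarrow> 0 * B"
      using q q0 by (intro tendsto_mult LIMSEQ_power_zero tendsto_const) auto
    then have "eventually (\<lambda>n. q ^ n * B < e) sequentially"
      using order_tendstoD(2)[of _ "0 * B" _ e] \<open>e > 0\<close> by auto
    then obtain n where n: "q ^ n * B < e" by (auto simp: eventually_sequentially)
    have "eventually (\<lambda>x. x \<ge> max 1 (2 ^ n * X)) at_top" by (rule eventually_ge_at_top)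
    then show "eventually (\<lambda>x. dist (f x / x) 0 < e) at_top"
    proof eventually_elim
      case (elim x)
      then have "k x \<le> q ^ n * B" "k x > 0" using B3 kpos by auto
      then show ?case using n by (simp add: k_def dist_real_def)
    qed
  qed
qed

section \<open>The function \<open>F\<close> and its inverse\<close>

lemma recip_primitive_deriv:
  assumes cont: "continuous_on {0..} f" and pos: "\<And>x. x \<ge> 0 \<Longrightarrow> f x > 0" and x: "x > 0"
  shows "(recip_primitive f has_real_derivative 1 / f x) (at x)"
proof -
  \<comment> \<open>The window must contain the base point 1 as well as \<open>x\<close>, on
    whichever side of 1 it lies, stay inside the positive reals, and have \<open>x\<close> in its
    interior so that the one-sided restriction disappears.\<close>
  define a b where "a = min 1 x / 2" and "b = max 1 x + 1"
  have ab: "0 < a" "a \<le> 1" "1 \<le> b" "a < x" "x < b" using x by (auto simp: a_def b_def)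
  have "((\<lambda>u. LBINT y=ereal 1..ereal u. 1 / f y) has_vector_derivative (1 / f x)) (at x within {a..b})"
    using ab
    by (intro interval_integral_FTC2 continuous_intros continuous_on_subset[OF cont])
       (use pos in \<open>auto simp: less_imp_neq[THEN not_sym]\<close>)
  moreover have "at x within {a..b} = at x" using ab by (intro at_within_Icc_at) auto
  ultimately show ?thesis
    unfolding recip_primitive_def by (simp add: has_real_derivative_iff_has_vector_derivative)
qed

lemma recip_primitive_strict_mono:
  assumes cont: "continuous_on {0..} f" and pos: "\<And>x. x \<ge> 0 \<Longrightarrow> f x > 0" and "0 < x" "x < y"
  shows "recip_primitive f x < recip_primitive f y"
proof (rule DERIV_pos_imp_increasing[OF \<open>x < y\<close>])
  fix z assume "x \<le> z" "z \<le> y"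
  then show "\<exists>d. (recip_primitive f has_real_derivative d) (at z) \<and> 0 < d"
    using recip_primitive_deriv[OF cont pos, of z] assms by (intro exI[of _ "1 / f z"]) auto
qed

lemma recip_primitive_1 [simp]: "recip_primitive f 1 = 0"
  by (simp add: recip_primitive_def)

text \<open>Eventually \<open>f x \<le> x\<close>, so \<open>F\<close> grows at least as fast as the
  logarithm. This puts all large times into the range of \<open>F\<close>.\<close>

lemma recip_primitive_at_top:
  assumes cont: "continuous_on {0..} f" and rv: "regularly_varying f \<beta>" and "\<beta> < 1"
  shows "filterlim (recip_primitive f) at_top at_top"
proof -
  have pos: "f x > 0" if "x \<ge> 0" for x using rv that by (auto simp: regularly_varying_def)
  have "eventually (\<lambda>x. f x / x < 1) at_top"
    using order_tendstoD(2)[OF regularly_varying_sublinear[OF assms], of 1] by simp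
  then obtain X0 where X0: "\<And>x. x \<ge> X0 \<Longrightarrow> f x / x < 1" by (auto simp: eventually_at_top_linorder)
  define X where "X = max X0 1"
  have X: "X \<ge> 1" "\<And>x. x \<ge> X \<Longrightarrow> f x \<le> x"
  proof -
    show "X \<ge> 1" by (simp add: X_def)
    show "f x \<le> x" if "x \<ge> X" for x
      using X0[of x] that by (simp add: X_def)
  qed
  have ge: "recip_primitive f X - ln X + ln x \<le> recip_primitive f x" if "x \<ge> X" for x
  proof -
    have "recip_primitive f X - ln X \<le> recip_primitive f x - ln x"
    proof (rule DERIV_nonneg_imp_nondecreasing[OF that])
      fix z assume z: "X \<le> z" "z \<le> x"
      have "((\<lambda>z. recip_primitive f z - ln z) has_real_derivative 1 / f z - 1 / z) (at z)"
        using z X(1) by (intro DERIV_diff recip_primitive_deriv[OF cont pos] DERIV_ln_divide) auto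
      moreover have "1 / f z - 1 / z \<ge> 0"
        using X z pos[of z] by (auto intro!: divide_left_mono)
      ultimately show "\<exists>d. ((\<lambda>z. recip_primitive f z - ln z) has_real_derivative d) (at z) \<and> 0 \<le> d" by blast
    qed
    then show ?thesis by simp
  qed
  have "filterlim (\<lambda>x. recip_primitive f X - ln X + ln x) at_top at_top"
    by (intro filterlim_tendsto_add_at_top[OF tendsto_const] ln_at_top)
  then show ?thesis
    by (rule filterlim_at_top_mono) (use ge in \<open>auto simp: eventually_at_top_linorder\<close>)
qed

text \<open>L'Hospital takes the place of Karamata's theorem: the quotient of the derivatives is
  \<open>c * f x / f (c * x)\<close>, whose limit is given by regular variation of
  \<open>f\<close>.\<close>

lemma recip_primitive_scale:
  assumes cont: "continuous_on {0..} f" and rv: "regularly_varying f \<beta>" and "\<beta> < 1" and "c > 0"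
  shows "((\<lambda>x. recip_primitive f (c * x) / recip_primitive f x) \<longlongrightarrow> c powr (1 - \<beta>)) at_top"
proof (rule lhospital_at_top_at_top)
  have pos: "f x > 0" if "x \<ge> 0" for x using rv that by (auto simp: regularly_varying_def)
  show "filterlim (recip_primitive f) at_top at_top" by (rule recip_primitive_at_top[OF assms(1-3)])
  have ev: "eventually (\<lambda>x::real. x > 0) at_top" by (rule eventually_gt_at_top)
  then show "eventually (\<lambda>x. 1 / f x \<noteq> 0) at_top"
    by eventually_elim (use pos in \<open>auto simp: less_imp_neq[THEN not_sym]\<close>)
  show "eventually (\<lambda>x. (recip_primitive f has_real_derivative 1 / f x) (at x)) at_top"
    using ev by eventually_elim (rule recip_primitive_deriv[OF cont pos])
  show "eventually (\<lambda>x. ((\<lambda>x. recip_primitive f (c * x)) has_real_derivative 1 / f (c * x) * c) (at x)) at_top"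
    using ev
  proof eventually_elim
    case (elim x)
    have "((\<lambda>x. c * x) has_real_derivative c) (at x)" by (auto intro!: derivative_eq_intros)
    then show ?case
      using elim \<open>c > 0\<close> by (intro DERIV_chain2[where f = "recip_primitive f"] recip_primitive_deriv[OF cont pos]) auto
  qed
  have "((\<lambda>x. c / (f (c * x) / f x)) \<longlongrightarrow> c / c powr \<beta>) at_top"
    using rv \<open>c > 0\<close> by (intro tendsto_intros) (auto simp: regularly_varying_def)
  then show "((\<lambda>x. 1 / f (c * x) * c / (1 / f x)) \<longlongrightarrow> c powr (1 - \<beta>)) at_top"
    using \<open>c > 0\<close> by (simp add: powr_diff mult_ac)
qed

text \<open>The scaling exponent \<open>1 - \<beta>\<close> is positive, so a factor
  \<open>d > 1\<close> in the argument leaves a factor bounded away from 1 in the value of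
  \<open>F\<close>. Hence \<open>F (a t)\<close> eventually falls below \<open>F (d * b t)\<close>,
  and symmetrically for \<open>d < 1\<close>; \<open>e\<close> separates the two limits, and
  \<open>d\<close> leaves room for a strict final inequality.\<close>

lemma recip_primitive_asymp_inj:
  assumes cont: "continuous_on {0..} f" and rv: "regularly_varying f \<beta>" and "\<beta> < 1"
    and b: "filterlim b at_top G" and apos: "eventually (\<lambda>t. a t > 0) G"
    and ab: "((\<lambda>t. recip_primitive f (a t) / recip_primitive f (b t)) \<longlongrightarrow> 1) G"
  shows "((\<lambda>t. a t / b t) \<longlongrightarrow> 1) G"
proof (rule order_tendstoI)
  have pos: "f x > 0" if "x \<ge> 0" for x using rv that by (auto simp: regularly_varying_def)
  have mono: "x \<le> y" if "recip_primitive f x < recip_primitive f y" "x > 0" "y > 0" for x y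
    using that recip_primitive_strict_mono[OF cont pos, of y x] by force
  have bpos: "eventually (\<lambda>t. b t > 1) G" using b by (auto simp: filterlim_at_top_dense)
  have Fb: "recip_primitive f x > 0" if "x > 1" for x
    using recip_primitive_strict_mono[OF cont pos, of 1 x] that by simp
  have scale: "((\<lambda>t. recip_primitive f (c * b t) / recip_primitive f (b t)) \<longlongrightarrow> c powr (1 - \<beta>)) G" if "c > 0" for c
    using filterlim_compose[OF recip_primitive_scale[OF assms(1-3) that] b] .
  {
    fix c :: real assume "c > 1"
    then obtain d where d: "1 < d" "d < c" using dense by blast
    have "1 < d powr (1 - \<beta>)" using d \<open>\<beta> < 1\<close> by (intro gr_one_powr) auto
    then obtain e where e: "1 < e" "e < d powr (1 - \<beta>)" using dense by blast
    have "eventually (\<lambda>t. recip_primitive f (d * b t) / recip_primitive f (b t) > e) G"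
      using order_tendstoD(1)[OF scale e(2)] d by auto
    moreover have "eventually (\<lambda>t. recip_primitive f (a t) / recip_primitive f (b t) < e) G"
      using order_tendstoD(2)[OF ab e(1)] .
    ultimately show "eventually (\<lambda>t. a t / b t < c) G" using bpos apos
    proof eventually_elim
      case (elim t)
      then have "recip_primitive f (a t) / recip_primitive f (b t) < recip_primitive f (d * b t) / recip_primitive f (b t)"
        by linarith
      then have "recip_primitive f (a t) < recip_primitive f (d * b t)"
        using Fb[of "b t"] elim by (simp add: divide_less_cancel)
      then have "a t \<le> d * b t" using mono elim d by simp
      also have "\<dots> < c * b t" using d elim by auto
      finally show ?case using elim by (simp add: field_simps)
    qed
  }
  {
    fix c0 :: real assume "c0 < 1"
    \<comment> \<open>The given lower bound may be negative, while the scaling lemma needs a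
      positive factor.\<close>
    define c where "c = max c0 (1/2)"
    have c: "c0 \<le> c" "0 < c" "c < 1" using \<open>c0 < 1\<close> by (auto simp: c_def)
    then obtain d where d: "c < d" "d < 1" using dense by blast
    have "ln d < 0" using d c by auto
    then have "(1 - \<beta>) * ln d < 0" using \<open>\<beta> < 1\<close> by (intro mult_pos_neg) auto
    then have "d powr (1 - \<beta>) < 1" using d c by (simp add: powr_def)
    then obtain e where e: "e < 1" "d powr (1 - \<beta>) < e" using dense by blast
    have "eventually (\<lambda>t. recip_primitive f (d * b t) / recip_primitive f (b t) < e) G"
      using order_tendstoD(2)[OF scale e(2)] d c by auto
    moreover have "eventually (\<lambda>t. recip_primitive f (a t) / recip_primitive f (b t) > e) G"
      using order_tendstoD(1)[OF ab e(1)] .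
    ultimately show "eventually (\<lambda>t. c0 < a t / b t) G" using bpos apos
    proof eventually_elim
      case (elim t)
      then have "recip_primitive f (d * b t) / recip_primitive f (b t) < recip_primitive f (a t) / recip_primitive f (b t)"
        by linarith
      then have "recip_primitive f (d * b t) < recip_primitive f (a t)"
        using Fb[of "b t"] elim by (simp add: divide_less_cancel)
      then have "d * b t \<le> a t" using mono elim d c by simp
      moreover have "c * b t < d * b t" "c0 * b t \<le> c * b t" using d c elim by auto
      ultimately have "c0 * b t < a t" by linarith
      then show ?case using elim by (simp add: field_simps)
    qed
  }
qed

text \<open>As \<open>f\<close> is positive and continuous at 0, \<open>F\<close> has a finite limit
  there and its range is bounded below. Nonnegative \<open>t\<close> are safe: they lie between the
  value 0 at the point 1 and a large value of \<open>F\<close>.\<close>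

lemma recip_primitive_inv:
  assumes cont: "continuous_on {0..} f" and rv: "regularly_varying f \<beta>" and "\<beta> < 1" and "t \<ge> 0"
  shows "recip_primitive_inv f t > 0" "recip_primitive f (recip_primitive_inv f t) = t"
proof -
  have pos: "f x > 0" if "x \<ge> 0" for x using rv that by (auto simp: regularly_varying_def)
  have inj: "inj_on (recip_primitive f) {0<..}"
    by (rule linorder_inj_onI) (use recip_primitive_strict_mono[OF cont pos] in \<open>force+\<close>)
  have "eventually (\<lambda>x. recip_primitive f x \<ge> t \<and> x \<ge> 1) at_top"
    using recip_primitive_at_top[OF assms(1-3)] eventually_ge_at_top[of "1::real"]
    by (auto simp: filterlim_at_top intro: eventually_conj)
  then obtain y where y: "recip_primitive f y \<ge> t" "y \<ge> 1"
    by (auto simp: eventually_at_top_linorder)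
  have "\<exists>x\<ge>1. x \<le> y \<and> recip_primitive f x = t"
  proof (rule IVT)
    show "\<forall>x. 1 \<le> x \<and> x \<le> y \<longrightarrow> isCont (recip_primitive f) x"
      using DERIV_isCont[OF recip_primitive_deriv[OF cont pos]] by auto
  qed (use y \<open>t \<ge> 0\<close> in auto)
  then have im: "t \<in> recip_primitive f ` {0<..}" by force
  show "recip_primitive f (recip_primitive_inv f t) = t"
    unfolding recip_primitive_inv_def by (rule f_the_inv_into_f[OF inj im])
  show "recip_primitive_inv f t > 0"
    unfolding recip_primitive_inv_def using the_inv_into_into[OF inj im, of "{0<..}"] by auto
qed

lemma recip_primitive_inv_at_top:
  assumes cont: "continuous_on {0..} f" and rv: "regularly_varying f \<beta>" and "\<beta> < 1"
  shows "filterlim (recip_primitive_inv f) at_top at_top"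
  unfolding filterlim_at_top
proof
  fix Z :: real
  have pos: "f x > 0" if "x \<ge> 0" for x using rv that by (auto simp: regularly_varying_def)
  have "eventually (\<lambda>t. t > max 0 (recip_primitive f (max Z 1))) at_top" by (rule eventually_gt_at_top)
  then show "eventually (\<lambda>t. Z \<le> recip_primitive_inv f t) at_top"
  proof eventually_elim
    case (elim t)
    note i = recip_primitive_inv[OF assms, of t]
    show ?case
    proof (rule ccontr)
      assume "\<not> ?thesis"
      then have "recip_primitive f (recip_primitive_inv f t) < recip_primitive f (max Z 1)"
        using i elim by (intro recip_primitive_strict_mono[OF cont pos]) auto
      then show False using i elim by auto
    qed
  qed
qed

text \<open>This is the form in which regular variation enters the existence proof: linear growth
  prevents blow-up in finite time.\<close>

lemma regularly_varying_linear_growth: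
  assumes cont: "continuous_on {0..} f" and rv: "regularly_varying f \<beta>" and "\<beta> < 1"
  shows "\<exists>K>0. \<forall>u\<ge>0. f u \<le> K * (1 + u)"
proof -
  have "eventually (\<lambda>u. f u / u < 1) at_top"
    using order_tendstoD(2)[OF regularly_varying_sublinear[OF assms], of 1] by simp
  then obtain X where X: "\<And>u. X \<le> u \<Longrightarrow> f u / u < 1" by (auto simp: eventually_at_top_linorder)
  have "bounded (f ` {0..X})"
    by (intro compact_imp_bounded compact_continuous_image continuous_on_subset[OF cont]) auto
  then obtain B where B: "\<forall>u\<in>{0..X}. \<bar>f u\<bar> \<le> B" unfolding bounded_iff by auto
  have f0: "0 < f 0" using rv by (simp add: regularly_varying_def)
  define K where "K = \<bar>B\<bar> + 1 + f 0"
  have "f u \<le> K * (1 + u)" if u: "0 \<le> u" for u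
  proof -
    have "f u \<le> K * 1 \<or> f u \<le> K * u"
    \<comment> \<open>The point 0 is kept apart: if \<open>X\<close> is negative, \<open>B\<close>
      says nothing about \<open>f 0\<close>, and \<open>f u / u < 1\<close> holds trivially at 0
      because division by zero gives 0. The summand \<open>f 0\<close> in \<open>K\<close> covers
      it.\<close>
    proof (cases "u \<le> X \<or> u = 0")
      case True
      then have "f u \<le> \<bar>B\<bar> \<or> u = 0" using bspec[OF B, of u] u by auto
      then show ?thesis using f0 by (auto simp: K_def)
    next
      case False
      then have "f u < u" using X[of u] u by (simp add: divide_less_eq)
      also have "\<dots> \<le> K * u" using u f0 mult_right_mono[of 1 K u] by (simp add: K_def)
      finally show ?thesis by simp
    qed
    moreover have "0 \<le> K" "0 \<le> K * u" using u f0 by (auto simp: K_def)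
    ultimately show ?thesis by (auto simp: algebra_simps)
  qed
  moreover have "0 < K" using f0 by (simp add: K_def add_nonneg_pos)
  ultimately show ?thesis by blast
qed

section \<open>Absolutely continuous functions\<close>

lemma lipschitz_imp_absolutely_continuous_on:
  assumes "L-lipschitz_on I x"
  shows "absolutely_continuous_on I x"
  unfolding absolutely_continuous_on_def
proof (intro allI impI)
  fix e :: real assume "e > 0"
  have L: "L \<ge> 0" using assms lipschitz_on_nonneg by blast
  show "\<exists>\<delta>>0. \<forall>(n::nat) a b. (\<forall>k<n. a k \<le> b k \<and> {a k..b k} \<subseteq> I) \<longrightarrow>
        disjoint_family_on (\<lambda>k. {a k<..<b k}) {..<n} \<longrightarrow>
        (\<Sum>k<n. b k - a k) < \<delta> \<longrightarrow> (\<Sum>k<n. \<bar>x (b k) - x (a k)\<bar>) < e"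
  \<comment> \<open>The Lipschitz constant may be 0, hence \<open>L + 1\<close>.\<close>
  proof (intro exI[of _ "e / (L + 1)"] conjI allI impI)
    show "0 < e / (L + 1)" using L \<open>e > 0\<close> by auto
    fix n :: nat and a b :: "nat \<Rightarrow> real"
    assume *: "\<forall>k<n. a k \<le> b k \<and> {a k..b k} \<subseteq> I" and sm: "(\<Sum>k<n. b k - a k) < e / (L + 1)"
    have "(\<Sum>k<n. \<bar>x (b k) - x (a k)\<bar>) \<le> (\<Sum>k<n. (L + 1) * (b k - a k))"
    proof (rule sum_mono)
      fix k assume "k \<in> {..<n}"
      with * have "a k \<le> b k" "a k \<in> I" "b k \<in> I" by (auto simp: subset_eq)
      with lipschitz_onD[OF assms, of "b k" "a k"]
      show "\<bar>x (b k) - x (a k)\<bar> \<le> (L + 1) * (b k - a k)"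
        by (simp add: dist_real_def algebra_simps)
    qed
    also have "\<dots> = (L + 1) * (\<Sum>k<n. b k - a k)" by (simp add: sum_distrib_left)
    also have "\<dots> < e" using sm L by (simp add: field_simps)
    finally show "(\<Sum>k<n. \<bar>x (b k) - x (a k)\<bar>) < e" .
  qed
qed

text \<open>Absolute continuity in the form that gauge divisions produce: a finite set of
  non-overlapping closed intervals inside a set of small measure, in place of an indexed family with
  small total length.\<close>

lemma absolutely_continuous_on_sum_small:
  assumes ac: "absolutely_continuous_on {a..b} y" and "e > 0"
  shows "\<exists>\<delta>>0. \<forall>q U. finite q \<longrightarrow> (\<forall>K\<in>q. \<exists>u v. K = {u..v} \<and> u \<le> v \<and> K \<subseteq> {a..b} \<and> K \<subseteq> U) \<longrightarrow>
     (\<forall>K\<in>q. \<forall>K'\<in>q. K \<noteq> K' \<longrightarrow> interior K \<inter> interior K' = {}) \<longrightarrow>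
     U \<in> lmeasurable \<longrightarrow> measure lebesgue U < \<delta> \<longrightarrow> (\<Sum>K\<in>q. \<bar>y (Sup K) - y (Inf K)\<bar>) < e"
proof -
  obtain \<delta> where \<delta>: "\<delta> > 0" "\<And>(n::nat) c d. (\<forall>k<n. c k \<le> d k \<and> {c k..d k} \<subseteq> {a..b}) \<Longrightarrow>
        disjoint_family_on (\<lambda>k. {c k<..<d k}) {..<n} \<Longrightarrow> (\<Sum>k<n. d k - c k) < \<delta> \<Longrightarrow>
        (\<Sum>k<n. \<bar>y (d k) - y (c k)\<bar>) < e"
    using ac[unfolded absolutely_continuous_on_def, rule_format, OF \<open>e > 0\<close>] by blast
  show ?thesis
  proof (intro exI[of _ \<delta>] conjI allI impI \<delta>(1))
    fix q U assume fin: "finite q"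
      and K: "\<forall>K\<in>q. \<exists>u v. K = {u..v} \<and> u \<le> v \<and> K \<subseteq> {a..b} \<and> K \<subseteq> U"
      and disj: "\<forall>K\<in>q. \<forall>K'\<in>q. K \<noteq> K' \<longrightarrow> interior K \<inter> interior K' = {}"
      and U: "U \<in> lmeasurable" "measure lebesgue U < \<delta>"
    obtain h where h: "bij_betw h {..<card q} q"
      using ex_bij_betw_nat_finite[OF fin] by (auto simp: lessThan_atLeast0)
    define c d where "c k = Inf (h k)" and "d k = Sup (h k)" for k
    have hk: "h k = {c k..d k} \<and> c k \<le> d k \<and> {c k..d k} \<subseteq> {a..b} \<and> {c k..d k} \<subseteq> U" if "k < card q" for k
    proof -
      have "h k \<in> q" using h that by (auto simp: bij_betw_def)
      then obtain u v where "h k = {u..v}" "u \<le> v" "h k \<subseteq> {a..b}" "h k \<subseteq> U" using bspec[OF K] by blast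
      then show ?thesis by (auto simp: c_def d_def)
    qed
    have dis: "disjoint_family_on (\<lambda>k. {c k<..<d k}) {..<card q}"
      unfolding disjoint_family_on_def
    proof (intro ballI impI)
      fix i j assume ij: "i \<in> {..<card q}" "j \<in> {..<card q}" "i \<noteq> j"
      then have "h i \<in> q" "h j \<in> q" "h i \<noteq> h j" using h by (auto simp: bij_betw_def inj_on_def)
      then have "interior (h i) \<inter> interior (h j) = {}" using disj by blast
      then show "{c i<..<d i} \<inter> {c j<..<d j} = {}" using hk[of i] hk[of j] ij by auto
    qed
    \<comment> \<open>Open interiors are disjoint, so their lengths add up to the measure of a union
      that lies in \<open>U\<close>.\<close>
    have "(\<Sum>k<card q. d k - c k) = (\<Sum>k<card q. measure lebesgue {c k<..<d k})"
      using hk by (intro sum.cong) auto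
    also have "\<dots> = measure lebesgue (\<Union>k<card q. {c k<..<d k})"
      using dis by (intro measure_finite_Union[symmetric]) (use hk in auto)
    also have "\<dots> \<le> measure lebesgue U"
    proof (rule measure_mono_fmeasurable)
      show "(\<Union>k<card q. {c k<..<d k}) \<subseteq> U"
      proof
        fix z assume "z \<in> (\<Union>k<card q. {c k<..<d k})"
        then obtain k where "k < card q" "z \<in> {c k<..<d k}" by blast
        then have "z \<in> {c k..d k}" by auto
        then show "z \<in> U" using hk[OF \<open>k < card q\<close>] by blast
      qed
      show "(\<Union>k<card q. {c k<..<d k}) \<in> sets lebesgue" by (intro sets.finite_UN) auto
    qed (fact U)
    finally have "(\<Sum>k<card q. d k - c k) < \<delta>" using U by simp
    then have "(\<Sum>k<card q. \<bar>y (d k) - y (c k)\<bar>) < e"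
      using \<delta>(2) hk dis by blast
    also have "(\<Sum>k<card q. \<bar>y (d k) - y (c k)\<bar>) = (\<Sum>K\<in>q. \<bar>y (Sup K) - y (Inf K)\<bar>)"
      unfolding c_def d_def by (rule sum.reindex_bij_betw[OF h])
    finally show "(\<Sum>K\<in>q. \<bar>y (Sup K) - y (Inf K)\<bar>) < e" .
  qed
qed

text \<open>A gauge argument in two halves. At tags outside the exceptional null set,
  differentiability makes each interval contribute at most \<open>\<epsilon>\<close> times its
  length. At tags inside it, the gauge confines the intervals to an open set of small measure, and
  absolute continuity makes their total increment small.\<close>

theorem absolutely_continuous_on_FTC:
  fixes y g :: "real \<Rightarrow> real"
  assumes "a \<le> b" and ac: "absolutely_continuous_on {a..b} y"
    and der: "AE t in lebesgue. t \<in> {a<..<b} \<longrightarrow> (y has_real_derivative g t) (at t)"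
  shows "(g has_integral (y b - y a)) {a..b}"
proof -
  obtain N0 where N0: "{t. \<not> (t \<in> {a<..<b} \<longrightarrow> (y has_real_derivative g t) (at t))} \<subseteq> N0" "N0 \<in> null_sets lebesgue"
    using der unfolding eventually_ae_filter by auto
  \<comment> \<open>The derivative is given only on the open interval, so both endpoints join the
    exceptional set.\<close>
  define N where "N = insert a (insert b N0)"
  have "N \<in> null_sets lebesgue"
    unfolding N_def using N0(2) by (metis negligible_iff_null_sets negligible_insert)
  then have N: "negligible N" "N \<in> sets lebesgue" "emeasure lebesgue N = 0"
    by (auto simp: negligible_iff_null_sets)
  have derN: "(y has_real_derivative g t) (at t)" if "t \<in> {a..b} - N" for t
  proof -
    have "t \<in> {a<..<b}" "t \<notin> N0" using that by (auto simp: N_def)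
    then show ?thesis using N0(1) by blast
  qed
  \<comment> \<open>With value 0 on \<open>N\<close>, tags in \<open>N\<close> add nothing to the
    Riemann sum, and only the increments of \<open>y\<close> remain to be estimated there; the spike
    lemma returns to \<open>g\<close> at the end.\<close>
  define g' where "g' t = (if t \<in> N then 0 else g t)" for t
  have "(g' has_integral (y b - y a)) {a..b}"
    unfolding has_integral_real
  proof (intro allI impI)
    fix e :: real assume "e > 0"
    \<comment> \<open>The summand 1 covers the case \<open>a = b\<close>.\<close>
    define \<epsilon> where "\<epsilon> = e / (2 * (b - a + 1))"
    have \<epsilon>: "\<epsilon> > 0" using \<open>a \<le> b\<close> \<open>e > 0\<close> by (simp add: \<epsilon>_def)
    have "\<epsilon> * (b - a) < \<epsilon> * (b - a + 1)" using \<epsilon> by (intro mult_strict_left_mono) auto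
    also have "\<dots> = e/2" using \<open>a \<le> b\<close> by (simp add: \<epsilon>_def divide_simps)
    finally have \<epsilon>2: "\<epsilon> * (b - a) < e/2" .
    obtain \<delta> where \<delta>: "\<delta> > 0" "\<And>q U. finite q \<Longrightarrow> (\<forall>K\<in>q. \<exists>u v. K = {u..v} \<and> u \<le> v \<and> K \<subseteq> {a..b} \<and> K \<subseteq> U) \<Longrightarrow>
     (\<forall>K\<in>q. \<forall>K'\<in>q. K \<noteq> K' \<longrightarrow> interior K \<inter> interior K' = {}) \<Longrightarrow>
     U \<in> lmeasurable \<Longrightarrow> measure lebesgue U < \<delta> \<Longrightarrow> (\<Sum>K\<in>q. \<bar>y (Sup K) - y (Inf K)\<bar>) < e/2"
      using absolutely_continuous_on_sum_small[OF ac, of "e/2"] \<open>e > 0\<close> by auto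
    obtain U where U: "open U" "N \<subseteq> U" "(U - N) \<in> lmeasurable" "emeasure lebesgue (U - N) < ennreal \<delta>"
      using sets_lebesgue_outer_open[OF N(2) \<delta>(1)] by metis
    have "emeasure lebesgue U \<le> emeasure lebesgue (U - N) + emeasure lebesgue N"
    proof -
      have "U = (U - N) \<union> N" using U(2) by auto
      then show ?thesis using emeasure_subadditive[of "U - N" lebesgue N] U N by (auto simp: fmeasurableD)
    qed
    then have "emeasure lebesgue U < ennreal \<delta>" using U N by simp
    then have U': "U \<in> lmeasurable" "measure lebesgue U < \<delta>"
      using U(1) \<delta>(1) by (auto simp: fmeasurable_def measure_def enn2real_less_iff less_trans[OF _ ennreal_less_top])
    have "\<exists>r>0. (t \<in> N \<longrightarrow> ball t r \<subseteq> U) \<and>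
        (t \<in> {a..b} - N \<longrightarrow> (\<forall>z. \<bar>z - t\<bar> < r \<longrightarrow> \<bar>y z - y t - g t * (z - t)\<bar> \<le> \<epsilon> * \<bar>z - t\<bar>))" for t
    proof (cases "t \<in> N")
      case True then show ?thesis using U(1,2) by (meson DiffD2 open_contains_ball subsetD)
    next
      case False
      show ?thesis
      proof (cases "t \<in> {a..b}")
        case True
        then have "(y has_derivative (\<lambda>h. g t * h)) (at t)"
          using derN[of t] False by (simp add: has_field_derivative_def)
        then obtain r where "r > 0" "\<And>z. norm (z - t) < r \<Longrightarrow> norm (y z - y t - g t * (z - t)) \<le> \<epsilon> * norm (z - t)"
          using \<epsilon> unfolding has_derivative_at_alt by blast
        then show ?thesis using False by auto
      qed (use False in \<open>auto intro: exI[of _ 1]\<close>)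
    qed
    then obtain r where r: "\<And>t. r t > 0" "\<And>t. t \<in> N \<Longrightarrow> ball t (r t) \<subseteq> U"
      "\<And>t z. t \<in> {a..b} - N \<Longrightarrow> \<bar>z - t\<bar> < r t \<Longrightarrow> \<bar>y z - y t - g t * (z - t)\<bar> \<le> \<epsilon> * \<bar>z - t\<bar>"
      by metis
    define \<gamma> where "\<gamma> t = ball t (r t)" for t
    show "\<exists>\<gamma>. gauge \<gamma> \<and> (\<forall>\<D>. \<D> tagged_division_of {a..b} \<and> \<gamma> fine \<D> \<longrightarrow>
          norm ((\<Sum>(x, k)\<in>\<D>. measure lborel k *\<^sub>R g' x) - (y b - y a)) < e)"
    proof (intro exI[of _ \<gamma>] conjI allI impI)
      show "gauge \<gamma>" unfolding gauge_def \<gamma>_def using r(1) by auto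
      fix p assume "p tagged_division_of {a..b} \<and> \<gamma> fine p"
      then have p: "p tagged_division_of {a..b}" and fine: "\<gamma> fine p" by auto
      note pD = tagged_division_ofD[OF p]
      have K: "\<exists>u v. K = {u..v} \<and> u \<le> t \<and> t \<le> v \<and> {u..v} \<subseteq> {a..b} \<and> {u..v} \<subseteq> ball t (r t)" if tK: "(t, K) \<in> p" for t K
      proof -
        obtain u v where "K = cbox u v" using pD(4)[OF tK] by blast
        then show ?thesis using pD(2,3)[OF tK] fineD[OF fine tK] by (auto simp: \<gamma>_def)
      qed
      let ?D = "\<lambda>(t, K). measure lborel K * g' t - (y (Sup K) - y (Inf K))"
      define p1 p2 where "p1 = {(t, K) \<in> p. t \<notin> N}" and "p2 = {(t, K) \<in> p. t \<in> N}"
      have fin: "finite p" "finite p1" "finite p2" using pD(1) by (auto simp: p1_def p2_def intro: finite_subset)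
      have "\<bar>sum ?D p1\<bar> \<le> (\<Sum>(t, K)\<in>p1. \<epsilon> * measure lborel K)"
      proof (rule order_trans[OF sum_abs], rule sum_mono, clarify)
        fix t K assume "(t, K) \<in> p1"
        then have tK: "(t, K) \<in> p" "t \<notin> N" by (auto simp: p1_def)
        then obtain u v where uv: "K = {u..v}" "u \<le> t" "t \<le> v" "{u..v} \<subseteq> {a..b}" "{u..v} \<subseteq> ball t (r t)"
          using K[OF tK(1)] by blast
        then have "u \<in> ball t (r t)" "v \<in> ball t (r t)" by (metis atLeastAtMost_iff order.trans order_refl subsetD)+
        then have 1: "\<bar>u - t\<bar> < r t" "\<bar>v - t\<bar> < r t" by (auto simp: dist_real_def)
        have t: "t \<in> {a..b} - N" using uv tK by auto
        have 2: "\<bar>y u - y t - g t * (u - t)\<bar> \<le> \<epsilon> * (t - u)" "\<bar>y v - y t - g t * (v - t)\<bar> \<le> \<epsilon> * (v - t)"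
          using r(3)[OF t 1(1)] r(3)[OF t 1(2)] uv by auto
        \<comment> \<open>Straddling: the tag lies between \<open>u\<close> and \<open>v\<close>, so
          the linearisation errors at the two ends are bounded by \<open>\<epsilon>\<close> times
          \<open>t - u\<close> and \<open>v - t\<close>, which add up to the length of the
          interval.\<close>
        have "(v - u) * g t - (y v - y u) = (y u - y t - g t * (u - t)) - (y v - y t - g t * (v - t))"
          by (simp add: algebra_simps)
        then have "\<bar>(v - u) * g t - (y v - y u)\<bar> \<le> \<epsilon> * (t - u) + \<epsilon> * (v - t)" using 2 by linarith
        then show "\<bar>measure lborel K * g' t - (y (Sup K) - y (Inf K))\<bar> \<le> \<epsilon> * measure lborel K"
          using uv tK(2) by (simp add: g'_def algebra_simps)
      qed
      also have "\<dots> \<le> (\<Sum>(t, K)\<in>p. \<epsilon> * measure lborel K)"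
        using \<epsilon> fin by (intro sum_mono2) (auto simp: p1_def)
      also have "\<dots> = \<epsilon> * (\<Sum>(t, K)\<in>p. measure lborel K)" by (simp add: sum_distrib_left case_prod_unfold)
      also have "\<dots> = \<epsilon> * (b - a)"
        using additive_content_tagged_division[of p a b] p \<open>a \<le> b\<close> by simp
      finally have S1: "\<bar>sum ?D p1\<bar> < e/2" using \<epsilon>2 by simp
      have ne: "K \<noteq> {}" if "(t, K) \<in> p2" for t K
        using that pD(2)[of t K] by (auto simp: p2_def)
      let ?E = "\<lambda>K. \<bar>y (Sup K) - y (Inf K)\<bar>"
      have "\<bar>sum ?D p2\<bar> \<le> (\<Sum>(t, K)\<in>p2. ?E K)"
        by (rule order_trans[OF sum_abs], rule sum_mono) (auto simp: p2_def g'_def)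
      \<comment> \<open>Different tags can carry the same interval only if it is degenerate, where
        the increment is 0; so the sum over pairs is a sum over intervals. The lemma used for this
        also asks for 0 at the empty interval, where \<open>Sup\<close> and \<open>Inf\<close> are
        unspecified; hence the case distinction.\<close>
      also have "\<dots> = (\<Sum>(t, K)\<in>p2. if K = {} then 0 else ?E K)"
        using ne by (intro sum.cong) auto
      also have "\<dots> = (\<Sum>K\<in>snd ` p2. if K = {} then 0 else ?E K)"
      proof -
        have p2: "p2 tagged_division_of \<Union>(snd ` p2)"
          using tagged_partial_division_of_Union_self[OF tagged_partial_division_subset[OF tagged_division_of_def[THEN iffD1, OF p, THEN conjunct1], of p2]]
          by (auto simp: p2_def)
        show ?thesis
        proof (rule sum.over_tagged_division_lemma[OF p2])
          fix u v :: real assume "box u v = {}"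
          then show "(if cbox u v = {} then 0 else ?E (cbox u v)) = 0" by (cases "u = v") auto
        qed
      qed
      also have "\<dots> = (\<Sum>K\<in>snd ` p2. ?E K)"
        using ne by (intro sum.cong) auto
      also have "\<dots> < e/2"
      proof (rule \<delta>(2)[OF _ _ _ U'])
        show "\<forall>K\<in>snd ` p2. \<exists>u v. K = {u..v} \<and> u \<le> v \<and> K \<subseteq> {a..b} \<and> K \<subseteq> U"
        proof
          fix K assume "K \<in> snd ` p2"
          then obtain t where "(t, K) \<in> p" "t \<in> N" by (auto simp: p2_def)
          moreover from K[OF this(1)] obtain u v where
            "K = {u..v}" "u \<le> t" "t \<le> v" "{u..v} \<subseteq> {a..b}" "{u..v} \<subseteq> ball t (r t)" by blast
          ultimately show "\<exists>u v. K = {u..v} \<and> u \<le> v \<and> K \<subseteq> {a..b} \<and> K \<subseteq> U"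
            using r(2)[of t] by (intro exI[of _ u] exI[of _ v]) auto
        qed
        show "\<forall>K\<in>snd ` p2. \<forall>K'\<in>snd ` p2. K \<noteq> K' \<longrightarrow> interior K \<inter> interior K' = {}"
          using pD(5) by (force simp: p2_def)
      qed (use fin in auto)
      finally have S2: "\<bar>sum ?D p2\<bar> < e/2" .
      have "p = p1 \<union> p2" "p1 \<inter> p2 = {}" by (auto simp: p1_def p2_def)
      then have "sum ?D p = sum ?D p1 + sum ?D p2" using fin by (simp add: sum.union_disjoint)
      moreover have "sum ?D p = (\<Sum>(t, K)\<in>p. measure lborel K * g' t) - (\<Sum>(t, K)\<in>p. y (Sup K) - y (Inf K))"
        by (simp add: sum_subtractf case_prod_unfold)
      moreover have "(\<Sum>(t, K)\<in>p. y (Sup K) - y (Inf K)) = y b - y a"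
        by (rule additive_tagged_division_1[OF \<open>a \<le> b\<close> p])
      ultimately show "norm ((\<Sum>(x, k)\<in>p. measure lborel k *\<^sub>R g' x) - (y b - y a)) < e"
        using S1 S2 by simp
    qed
  qed
  then show ?thesis
    by (rule has_integral_spike[OF N(1), rotated]) (auto simp: g'_def)
qed

text \<open>The definition is matched with the time-dependent notion \<open>local_lipschitz\<close>,
  using a single dummy time, whose compactness theorem then applies.\<close>

lemma locally_lipschitz_on_compact_subset:
  assumes "locally_lipschitz_on S f" "compact X" "X \<subseteq> S" "continuous_on S f"
  shows "\<exists>L. L-lipschitz_on X f"
proof -
  have "local_lipschitz {0::real} X (\<lambda>_. f)"
  proof (rule local_lipschitzI)
    fix t x :: real assume "x \<in> X"
    then obtain u L where u: "0 < u" "L-lipschitz_on (cball x u \<inter> S) f"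
      using assms(1,3) unfolding locally_lipschitz_on_def by blast
    then have "L-lipschitz_on (cball x u \<inter> X) f"
      using assms(3) by (blast intro: lipschitz_on_subset)
    with u(1) show "\<exists>u>0. \<exists>L. \<forall>t\<in>cball t u \<inter> {0}. L-lipschitz_on (cball x u \<inter> X) f" by blast
  qed
  then obtain L where "\<And>t::real. t \<in> {0} \<Longrightarrow> L-lipschitz_on X f"
    by (rule local_lipschitz_compact_implies_lipschitz) (use assms in auto)
  then show ?thesis by blast
qed

section \<open>Convolution with a delay measure\<close>

lemma bounded_borel_integrable:
  fixes h :: "real \<Rightarrow> real"
  assumes [measurable]: "h \<in> borel_measurable borel" and bd: "\<And>u. u \<in> {a..b} \<Longrightarrow> \<bar>h u\<bar> \<le> B"
  shows "set_integrable lborel {a..b} h"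
  unfolding set_integrable_def
  by (rule integrableI_bounded_set_indicator[where B = B]) (use bd in \<open>auto simp: emeasure_lborel_Icc_eq\<close>)

text \<open>Delays are measures on the whole line without mass below 0. Convolution then needs no
  restriction of domain, and its value at \<open>t\<close> depends only on the past of
  \<open>t\<close>.\<close>

locale delay_measure = finite_measure \<nu> for \<nu> :: "real measure" +
  assumes sets_borel [measurable_cong]: "sets \<nu> = sets borel"
    and null_neg: "emeasure \<nu> {..<0} = 0"
begin

definition conv :: "(real \<Rightarrow> real) \<Rightarrow> real \<Rightarrow> real" where
  "conv h t = (LINT s|\<nu>. h (t - s))"

abbreviation mass :: real where "mass \<equiv> measure \<nu> UNIV"

lemma space_UNIV [simp]: "space \<nu> = UNIV"
  using sets_eq_imp_space_eq[OF sets_borel] by simp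

lemma AE_nonneg: "AE s in \<nu>. 0 \<le> s"
  by (rule AE_I[where N = "{..<0}"]) (auto simp: null_neg sets_borel)

lemma integrable_shift:
  fixes h :: "real \<Rightarrow> real"
  assumes [measurable]: "h \<in> borel_measurable borel" and bd: "\<And>u. u \<le> t \<Longrightarrow> \<bar>h u\<bar> \<le> B"
  shows "integrable \<nu> (\<lambda>s. h (t - s))"
proof (rule integrable_const_bound[where B = B])
  show "AE s in \<nu>. norm (h (t - s)) \<le> B"
    using AE_nonneg by eventually_elim (auto intro: bd)
qed measurable

lemma conv_nonneg: "(\<And>u. 0 \<le> h u) \<Longrightarrow> 0 \<le> conv h t"
  unfolding conv_def by simp

text \<open>The bounds \<open>B\<close> and \<open>C\<close> serve integrability alone; the estimate
  is governed by \<open>D\<close>.\<close>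

lemma conv_diff_bound:
  assumes h: "h \<in> borel_measurable borel" "\<And>u. u \<le> t \<Longrightarrow> \<bar>h u\<bar> \<le> B"
    and k: "k \<in> borel_measurable borel" "\<And>u. u \<le> t \<Longrightarrow> \<bar>k u\<bar> \<le> C"
    and d: "\<And>u. u \<le> t \<Longrightarrow> \<bar>h u - k u\<bar> \<le> D"
  shows "\<bar>conv h t - conv k t\<bar> \<le> D * mass"
proof -
  note ih = integrable_shift[OF h] and ik = integrable_shift[OF k]
  have "conv h t - conv k t = (LINT s|\<nu>. h (t - s) - k (t - s))"
    unfolding conv_def using ih ik by simp
  also have "\<bar>\<dots>\<bar> \<le> (LINT s|\<nu>. \<bar>h (t - s) - k (t - s)\<bar>)" by (rule integral_abs_bound)
  also have "\<dots> \<le> (LINT s|\<nu>. D)"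
  proof (rule integral_mono_AE)
    show "AE s in \<nu>. \<bar>h (t - s) - k (t - s)\<bar> \<le> D"
      using AE_nonneg by eventually_elim (auto intro: d)
  qed (use ih ik in auto)
  finally show ?thesis by (simp add: mult.commute)
qed

lemma conv_bound:
  assumes h: "h \<in> borel_measurable borel" "\<And>u. u \<le> t \<Longrightarrow> \<bar>h u\<bar> \<le> B"
  shows "\<bar>conv h t\<bar> \<le> B * mass"
  using conv_diff_bound[OF h, where k = "\<lambda>_. 0" and C = 0 and D = B] h(2) by (simp add: conv_def)

lemma conv_cong:
  assumes "\<And>u. u \<le> t \<Longrightarrow> h u = k u" "h \<in> borel_measurable borel" "k \<in> borel_measurable borel"
  shows "conv h t = conv k t"
  unfolding conv_def
proof (rule integral_cong_AE)
  show "AE s in \<nu>. h (t - s) = k (t - s)"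
    using AE_nonneg by eventually_elim (auto intro: assms)
qed (use assms in measurable)

lemma borel_measurable_conv:
  assumes [measurable]: "h \<in> borel_measurable borel"
  shows "conv h \<in> borel_measurable borel"
  unfolding conv_def[abs_def]
  by (rule borel_measurable_lebesgue_integral) measurable

text \<open>Dominated convergence: the only discontinuity \<open>a\<close> of \<open>h\<close> is
  met at the lag \<open>s = t - a\<close>, which is assumed to carry no mass.\<close>

lemma isCont_conv:
  assumes h: "h \<in> borel_measurable borel" "\<And>u. u \<le> T \<Longrightarrow> \<bar>h u\<bar> \<le> B" and "t < T"
    and c: "\<And>u. u < T \<Longrightarrow> u \<noteq> a \<Longrightarrow> isCont h u" and atom: "measure \<nu> {t - a} = 0"
  shows "isCont (conv h) t"
proof -
  note [measurable] = h(1)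
  \<comment> \<open>Truncation beyond \<open>T\<close> yields one dominating constant for all
    arguments and leaves the convolution unchanged near \<open>t\<close>.\<close>
  define h' where "h' u = (if u \<le> T then h u else 0)" for u
  have [measurable]: "h' \<in> borel_measurable borel" unfolding h'_def by measurable
  have B: "\<bar>h' u\<bar> \<le> \<bar>B\<bar>" for u using h(2)[of u] by (auto simp: h'_def)
  have ch': "isCont h' u" if "u < T" "u \<noteq> a" for u
  proof -
    have "eventually (\<lambda>z. z < T) (nhds u)" using that(1) by (rule order_tendstoD[OF filterlim_ident])
    then have "eventually (\<lambda>z. h' z = h z) (nhds u)"
      by eventually_elim (simp add: h'_def)
    from isCont_cong[OF this] c[OF that] show ?thesis by simp
  qed
  have "emeasure \<nu> {t - a} = 0" using atom by (simp add: emeasure_eq_measure)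
  then have na: "AE s in \<nu>. s \<noteq> t - a"
    by (intro AE_I[where N = "{t - a}"]) (auto simp: sets_borel)
  have "isCont (conv h') t"
    unfolding continuous_at_sequentially comp_def
  proof (intro allI impI)
    fix x :: "nat \<Rightarrow> real" assume x: "x \<longlonglongrightarrow> t"
    show "(\<lambda>n. conv h' (x n)) \<longlonglongrightarrow> conv h' t"
      unfolding conv_def
    proof (rule integral_dominated_convergence[where w = "\<lambda>_. \<bar>B\<bar>"])
      show "AE s in \<nu>. (\<lambda>n. h' (x n - s)) \<longlonglongrightarrow> h' (t - s)"
        using na AE_nonneg
      proof eventually_elim
        case (elim s)
        then have "isCont h' (t - s)" using \<open>t < T\<close> by (intro ch') auto
        then show ?case using x by (auto intro: isCont_tendsto_compose intro!: tendsto_intros)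
      qed
    qed (use B in auto)
  qed
  moreover have "eventually (\<lambda>z. conv h' z = conv h z) (nhds t)"
  proof -
    have "eventually (\<lambda>z. z < T) (nhds t)" using \<open>t < T\<close> by (rule order_tendstoD[OF filterlim_ident])
    then show ?thesis by eventually_elim (auto intro!: conv_cong simp: h'_def)
  qed
  ultimately show ?thesis using isCont_cong by blast
qed

lemma countable_atoms: "countable {t. measure \<nu> {t - a} \<noteq> 0}"
proof -
  have "{t. measure \<nu> {t - a} \<noteq> 0} = (\<lambda>s. s + a) ` {s. measure \<nu> {s} \<noteq> 0}"
    by (force simp: image_iff)
  then show ?thesis using countable_support by auto
qed

text \<open>By Fubini the integral is the average over \<open>s\<close> of the integral of
  \<open>h\<close> over \<open>[-s, t - s]\<close>. For \<open>s \<ge> 0\<close> the part of this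
  window above \<open>a\<close> lies in \<open>[a, t]\<close>, and for
  \<open>0 \<le> s \<le> S\<close> the window contains \<open>[0, t - S]\<close>; since
  \<open>h\<close> is nonnegative, inclusion of windows is all that is compared.\<close>

lemma integral_conv_bounds:
  assumes h: "h \<in> borel_measurable borel" "\<And>u. u \<le> t \<Longrightarrow> h u \<le> B" "\<And>u. 0 \<le> h u"
    and a: "\<And>u. u < a \<Longrightarrow> h u = 0" and "a \<le> 0" "0 \<le> t"
  shows integral_conv_le: "integral {0..t} (conv h) \<le> mass * integral {a..t} h"
    and integral_conv_ge: "0 \<le> S \<Longrightarrow> S \<le> t \<Longrightarrow> measure \<nu> {0..S} * integral {0..t - S} h \<le> integral {0..t} (conv h)"
proof -
  note [measurable] = h(1)
  \<comment> \<open>Only values up to \<open>t\<close> matter; dropping the rest makes the integrand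
    bounded on the product space, as Fubini requires.\<close>
  define h' where "h' u = (if u \<le> t then h u else 0)" for u
  have h'm [measurable]: "h' \<in> borel_measurable borel" unfolding h'_def by measurable
  have B0: "0 \<le> B" using h(2,3)[of t] by auto
  have h'B: "\<bar>h' u\<bar> \<le> B" "0 \<le> h' u" for u using h(2,3)[of u] B0 by (auto simp: h'_def)
  have ceq: "conv h u = conv h' u" if "u \<le> t" for u
    using that by (intro conv_cong) (auto simp: h'_def)
  have hint: "set_integrable lborel {u..v} h'" for u v
    using h'B by (intro bounded_borel_integrable[where B = B]) auto
  have hi: "(LINT z|lborel. indicator {u..v} z * h' z) = integral {u..v} h" if "v \<le> t" for u v
  proof -
    have "(LINT z|lborel. indicator {u..v} z * h' z) = integral {u..v} h'"
      using set_borel_integral_eq_integral(2)[OF hint] by (simp add: set_lebesgue_integral_def)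
    also have "\<dots> = integral {u..v} h" using that by (intro integral_cong) (auto simp: h'_def)
    finally show ?thesis .
  qed
  interpret P: pair_sigma_finite lborel \<nu> ..
  have int: "integrable (lborel \<Otimes>\<^sub>M \<nu>) (case_prod (\<lambda>u s. indicator {0..t} u * h' (u - s)))"
  proof (rule integrableI_bounded_set[where A = "{0..t} \<times> UNIV" and B = B])
    show "emeasure (lborel \<Otimes>\<^sub>M \<nu>) ({0..t} \<times> UNIV) < \<infinity>"
      using \<open>0 \<le> t\<close> 
      by (subst emeasure_pair_measure_Times) (auto simp: ennreal_mult_less_top sets_borel emeasure_eq_measure)
    show "AE x\<in>{0..t} \<times> UNIV in lborel \<Otimes>\<^sub>M \<nu>. norm (case x of (u, s) \<Rightarrow> indicator {0..t} u * h' (u - s)) \<le> B"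
      using h'B by (auto simp: indicator_def)
    show "AE x in lborel \<Otimes>\<^sub>M \<nu>. x \<notin> {0..t} \<times> UNIV \<longrightarrow> (case x of (u, s) \<Rightarrow> indicator {0..t} u * h' (u - s)) = 0"
      by (intro AE_I2) (auto simp: indicator_def)
  qed (auto simp: sets_borel intro!: pair_measureI)
  \<comment> \<open>The inner integral after the substitution \<open>z = u - s\<close>.\<close>
  define Y where "Y s = (LINT z|lborel. indicator {0..t} (z + s) * h' z)" for s
  have Yeq: "(LINT u|lborel. indicator {0..t} u * h' (u - s)) = Y s" for s
    unfolding Y_def by (subst lborel_integral_real_affine[where c = 1 and t = s]) (auto simp: add.commute)
  have "integral {0..t} (conv h) = integral {0..t} (conv h')"
    by (intro integral_cong) (auto simp: ceq)
  also have "\<dots> = (LINT u|lborel. indicator {0..t} u * conv h' u)"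
  proof -
    have "set_integrable lborel {0..t} (conv h')"
      by (rule bounded_borel_integrable[OF borel_measurable_conv, where B = "B * mass"])
         (use h'B in \<open>auto intro!: conv_bound\<close>)
    then show ?thesis using set_borel_integral_eq_integral(2) by (fastforce simp: set_lebesgue_integral_def)
  qed
  also have "\<dots> = (LINT u|lborel. LINT s|\<nu>. indicator {0..t} u * h' (u - s))"
    by (simp add: conv_def)
  also have "\<dots> = (LINT s|\<nu>. Y s)"
    using P.Fubini_integral[OF int] by (simp add: Yeq)
  finally have main: "integral {0..t} (conv h) = (LINT s|\<nu>. Y s)" .
  have Yint: "integrable \<nu> Y"
    using P.integrable_snd[OF int] by (simp add: Yeq)
  have iY: "integrable lborel (\<lambda>z. indicator {0..t} (z + s) * h' z)" for s
  proof -
    have "(\<lambda>z. indicator {0..t} (z + s) * h' z) = (\<lambda>z. indicator {-s..t - s} z * h' z)"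
      by (auto simp: indicator_def fun_eq_iff)
    then show ?thesis using hint[of "-s" "t - s"] by (simp add: set_integrable_def)
  qed
  have iI: "integrable lborel (\<lambda>z. indicator {u..v} z * h' z)" for u v
    using hint by (simp add: set_integrable_def)
  show "integral {0..t} (conv h) \<le> mass * integral {a..t} h"
  proof -
    have "(LINT s|\<nu>. Y s) \<le> (LINT s|\<nu>. integral {a..t} h)"
    proof (rule integral_mono_AE)
      show "AE s in \<nu>. Y s \<le> integral {a..t} h"
        using AE_nonneg
      proof eventually_elim
        case (elim s)
        have "indicator {0..t} (z + s) * h' z \<le> indicator {a..t} z * h' z" for z
          using elim a[of z] h'B(2)[of z] by (auto simp: indicator_def h'_def)
        then have "Y s \<le> (LINT z|lborel. indicator {a..t} z * h' z)"
          unfolding Y_def by (intro integral_mono iY iI) auto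
        then show ?case by (simp add: hi)
      qed
    qed (use Yint in auto)
    then show ?thesis by (simp add: main)
  qed
  assume S: "0 \<le> S" "S \<le> t"
  show "measure \<nu> {0..S} * integral {0..t - S} h \<le> integral {0..t} (conv h)"
  proof -
    have "(LINT s|\<nu>. indicator {0..S} s * integral {0..t - S} h) \<le> (LINT s|\<nu>. Y s)"
    proof (rule integral_mono_AE)
      show "integrable \<nu> (\<lambda>s. indicator {0..S} s * integral {0..t - S} h)"
        by (intro integrable_mult_left integrable_real_indicator) (auto simp: sets_borel less_top[symmetric])
      show "AE s in \<nu>. indicator {0..S} s * integral {0..t - S} h \<le> Y s"
        using AE_nonneg
      proof eventually_elim
        case (elim s)
        show ?case
        \<comment> \<open>Lags beyond \<open>S\<close> are simply discarded, which nonnegativity of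
          \<open>Y\<close> permits.\<close>
        proof (cases "s \<le> S")
          case True
          have "indicator {0..t - S} z * h' z \<le> indicator {0..t} (z + s) * h' z" for z
            using elim True h'B(2)[of z] by (auto simp: indicator_def)
          then have "(LINT z|lborel. indicator {0..t - S} z * h' z) \<le> Y s"
            unfolding Y_def by (intro integral_mono iY iI) auto
          then show ?thesis using True elim S by (simp add: hi)
        next
          case False
          moreover have "0 \<le> Y s" unfolding Y_def using h'B(2) by (intro Bochner_Integration.integral_nonneg) auto
          ultimately show ?thesis by simp
        qed
      qed
    qed (use Yint in auto)
    then show ?thesis by (simp add: main)
  qed
qed

end

text \<open>A measure on the half-line is restricted to \<open>A\<close> and pushed forward to the
  line by the identity. Restricting first matters because only the mass of \<open>A\<close> is
  assumed finite.\<close>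

lemma delay_measure_distr:
  fixes \<mu> :: "real measure"
  assumes s: "sets \<mu> = sets (restrict_space borel {0..})" and A: "A \<in> sets \<mu>" and fin: "emeasure \<mu> A < \<infinity>"
  defines "\<nu> \<equiv> distr (restrict_space \<mu> A) borel (\<lambda>s. s)"
  shows "delay_measure \<nu>" and "emeasure \<nu> UNIV = emeasure \<mu> A"
    and "\<And>h :: real \<Rightarrow> real. h \<in> borel_measurable borel \<Longrightarrow> (LINT s|\<nu>. h s) = (LINT s:A|\<mu>. h s)"
proof -
  have sp: "space \<mu> = {0..}" using sets_eq_imp_space_eq[OF s] by (simp add: space_restrict_space)
  then have A0: "A \<subseteq> {0..}" using sets.sets_into_space[OF A] by simp
  have "(\<lambda>s. s) \<in> \<mu> \<rightarrow>\<^sub>M borel"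
    using measurable_cong_sets[OF s refl, of "borel :: real measure"] by (simp add: measurable_restrict_space1)
  then have m: "(\<lambda>s. s) \<in> restrict_space \<mu> A \<rightarrow>\<^sub>M borel" by (rule measurable_restrict_space1)
  have e: "emeasure \<nu> B = emeasure \<mu> (B \<inter> A)" if "B \<in> sets borel" for B
  proof -
    have "B \<inter> space (restrict_space \<mu> A) = B \<inter> A" using A0 sp by (auto simp: space_restrict_space)
    then show ?thesis
      unfolding \<nu>_def using that A m
      by (simp add: emeasure_distr emeasure_restrict_space sets.Int_space_eq2)
  qed
  show tot: "emeasure \<nu> UNIV = emeasure \<mu> A" using e[of UNIV] by simp
  show "delay_measure \<nu>"
  proof (intro delay_measure.intro delay_measure_axioms.intro finite_measureI)
    show "sets \<nu> = sets borel" by (simp add: \<nu>_def)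
    show "emeasure \<nu> (space \<nu>) \<noteq> \<infinity>" using tot fin by (simp add: \<nu>_def)
    have "{..<0} \<inter> A = {}" using A0 by auto
    then show "emeasure \<nu> {..<0} = 0" by (simp add: e)
  qed
  show "(LINT s|\<nu>. h s) = (LINT s:A|\<mu>. h s)" if "h \<in> borel_measurable borel" for h :: "real \<Rightarrow> real"
    unfolding \<nu>_def
    using that m A by (simp add: integral_distr integral_restrict_space set_lebesgue_integral_def)
qed

text \<open>Cutting a history function off below \<open>0\<close> turns the convolution with a measure into an
  integral over \<open>[0, t]\<close>; the price is a jump of the convolution at the atoms of the measure.\<close>

definition cut :: "real \<Rightarrow> (real \<Rightarrow> real) \<Rightarrow> real \<Rightarrow> real" where
  "cut a \<phi> u = (if a \<le> u then \<phi> u else 0)"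

lemma borel_measurable_cut:
  assumes "continuous_on {a..} \<phi>"
  shows "cut a \<phi> \<in> borel_measurable borel"
proof -
  have "cut a \<phi> = (\<lambda>u. indicator {a..} u *\<^sub>R \<phi> u)"
    by (auto simp: cut_def fun_eq_iff)
  then show ?thesis using borel_measurable_continuous_on_indicator[OF _ assms] by simp
qed

lemma isCont_cut:
  assumes c: "continuous_on {a..} \<phi>" and "u \<noteq> a"
  shows "isCont (cut a \<phi>) u"
proof (cases "u < a")
  case True
  have "eventually (\<lambda>z. z < a) (nhds u)" using True by (rule order_tendstoD[OF filterlim_ident])
  then have "eventually (\<lambda>z. cut a \<phi> z = 0) (nhds u)" by eventually_elim (simp add: cut_def)
  from isCont_cong[OF this] show ?thesis by simp
next
  case False
  then have u: "a < u" using \<open>u \<noteq> a\<close> by simp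
  have "eventually (\<lambda>z. a < z) (nhds u)" using u by (rule order_tendstoD[OF filterlim_ident])
  then have ev: "eventually (\<lambda>z. cut a \<phi> z = \<phi> z) (nhds u)" by eventually_elim (simp add: cut_def)
  have "continuous_on {a<..} \<phi>" using c by (rule continuous_on_subset) auto
  then have "isCont \<phi> u" using u by (simp add: continuous_on_eq_continuous_at)
  with isCont_cong[OF ev] show ?thesis by simp
qed

text \<open>Below \<open>a\<close> the function is 0, so compactness of \<open>[a, T]\<close> bounds
  it on the whole past of \<open>T\<close>. Convolutions need this since lags may be arbitrarily
  large.\<close>

lemma cut_bounded:
  fixes \<phi> :: "real \<Rightarrow> real"
  assumes "continuous_on {a..} \<phi>"
  shows "\<exists>B\<ge>0. \<forall>u\<le>T. \<bar>cut a \<phi> u\<bar> \<le> B"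
proof -
  have "compact (\<phi> ` {a..T})"
    by (intro compact_continuous_image continuous_on_subset[OF assms]) auto
  then have "bounded (\<phi> ` {a..T})" by (rule compact_imp_bounded)
  then obtain B where "\<forall>u\<in>{a..T}. \<bar>\<phi> u\<bar> \<le> B" unfolding bounded_iff by auto
  then have "\<bar>cut a \<phi> u\<bar> \<le> \<bar>B\<bar>" if "u \<le> T" for u
    using that by (auto simp: cut_def intro: order_trans[OF _ abs_ge_self])
  then show ?thesis by (intro exI[of _ "\<bar>B\<bar>"]) auto
qed

lemma continuous_on_atLeastI:
  fixes g :: "real \<Rightarrow> real"
  assumes "\<And>T. continuous_on {a..T} g"
  shows "continuous_on {a..} g"
  unfolding continuous_on_eq_continuous_within
proof
  fix t assume t: "t \<in> {a..}"
  have "at t within {a..} = at t within {a..t + 1}"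
    by (rule at_within_nhd[of t "{..<t + 1}"]) auto
  then show "continuous (at t within {a..}) g"
    using assms[of "t + 1"] t by (auto simp: continuous_on_eq_continuous_within)
qed

section \<open>Existence and uniqueness\<close>

lemma has_integral_exp_linear:
  fixes c :: real
  assumes "c \<noteq> 0" "0 \<le> t"
  shows "((\<lambda>v. exp (c * v)) has_integral (exp (c * t) - 1) / c) {0..t}"
proof -
  have "((\<lambda>v. exp (c * v) / c) has_vector_derivative exp (c * v)) (at v within {0..t})" for v
    unfolding has_real_derivative_iff_has_vector_derivative[symmetric]
    using assms by (auto intro!: derivative_eq_intros)
  from fundamental_theorem_of_calculus[OF assms(2) this]
  show ?thesis by (simp add: diff_divide_distrib)
qed

text \<open>Regular variation enters here only through \<open>f_growth\<close>; it returns as a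
  separate hypothesis in the asymptotics.\<close>

locale delay_equation = D1: delay_measure \<nu>\<^sub>1 + D2: delay_measure \<nu>\<^sub>2
  for \<nu>\<^sub>1 \<nu>\<^sub>2 :: "real measure" +
  fixes \<tau> :: real and f \<psi> :: "real \<Rightarrow> real"
  assumes tau_pos: "0 < \<tau>"
    and f_cont: "continuous_on {0..} f" and f_pos: "\<And>u. 0 \<le> u \<Longrightarrow> 0 < f u"
    and f_lip: "\<And>R. \<exists>L. L-lipschitz_on {0..R} f"
    and f_growth: "\<exists>K>0. \<forall>u\<ge>0. f u \<le> K * (1 + u)"
    and \<psi>_cont: "continuous_on {-\<tau>..0} \<psi>" and \<psi>_pos: "\<And>t. t \<in> {-\<tau>..0} \<Longrightarrow> 0 < \<psi> t"
    and mass_pos: "0 < D1.mass + D2.mass"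
begin

section \<open>The right-hand side and the Picard map\<close>

definition M :: real where "M = D1.mass + D2.mass"

lemma M_pos: "0 < M"
  using mass_pos by (simp add: M_def)

definition admissible :: "(real \<Rightarrow> real) \<Rightarrow> bool" where
  "admissible x \<longleftrightarrow> continuous_on {-\<tau>..} x \<and> (\<forall>t\<ge>-\<tau>. 0 \<le> x t)"

text \<open>The cut at \<open>-\<tau>\<close> is inactive for \<open>t > 0\<close> and lags up to
  \<open>\<tau>\<close>, so the first term sees the whole history. The second integral ends at
  \<open>s = t\<close>, which is exactly a cut at 0.\<close>

definition rhs :: "(real \<Rightarrow> real) \<Rightarrow> real \<Rightarrow> real" where
  "rhs x t = D1.conv (cut (-\<tau>) (\<lambda>u. f (x u))) t + D2.conv (cut 0 (\<lambda>u. f (x u))) t"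

text \<open>\<open>min\<close> and \<open>max\<close> join both regimes in one formula: for
  \<open>t \<le> 0\<close> the integral vanishes, for \<open>t \<ge> 0\<close> the first summand is
  \<open>\<psi> 0\<close>.\<close>

definition picard :: "(real \<Rightarrow> real) \<Rightarrow> real \<Rightarrow> real" where
  "picard x t = \<psi> (min t 0) + integral {0..max t 0} (rhs x)"

lemma f_comp_cont:
  assumes "admissible x" "-\<tau> \<le> a"
  shows "continuous_on {a..} (\<lambda>u. f (x u))"
proof -
  have "continuous_on {a..} x"
    using assms by (auto simp: admissible_def intro: continuous_on_subset)
  moreover have "x ` {a..} \<subseteq> {0..}" using assms by (auto simp: admissible_def)
  ultimately show ?thesis by (rule continuous_on_compose2[OF f_cont])
qed

lemma cut_f_comp:
  assumes "admissible x" "-\<tau> \<le> a"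
  shows cut_borel: "cut a (\<lambda>u. f (x u)) \<in> borel_measurable borel"
    and cut_isCont: "u \<noteq> a \<Longrightarrow> isCont (cut a (\<lambda>u. f (x u))) u"
    and cut_nonneg: "0 \<le> cut a (\<lambda>u. f (x u)) u"
proof -
  show "cut a (\<lambda>u. f (x u)) \<in> borel_measurable borel"
    by (rule borel_measurable_cut[OF f_comp_cont[OF assms]])
  show "u \<noteq> a \<Longrightarrow> isCont (cut a (\<lambda>u. f (x u))) u"
    by (rule isCont_cut[OF f_comp_cont[OF assms]])
  show "0 \<le> cut a (\<lambda>u. f (x u)) u"
    using assms f_pos[of "x u"] by (auto simp: cut_def admissible_def)
qed

lemma tau0: "-\<tau> \<le> -\<tau>" "-\<tau> \<le> 0" using tau_pos by auto

lemma rhs_nonneg: "admissible x \<Longrightarrow> 0 \<le> rhs x t"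
  unfolding rhs_def
  by (intro add_nonneg_nonneg D1.conv_nonneg D2.conv_nonneg cut_nonneg tau0)

lemma rhs_borel: "admissible x \<Longrightarrow> rhs x \<in> borel_measurable borel"
  unfolding rhs_def[abs_def]
  by (intro borel_measurable_add D1.borel_measurable_conv D2.borel_measurable_conv cut_borel tau0)

lemma rhs_le:
  assumes x: "admissible x" and bd: "\<And>u. -\<tau> \<le> u \<Longrightarrow> u \<le> t \<Longrightarrow> f (x u) \<le> B" and "0 \<le> B"
  shows "rhs x t \<le> M * B"
proof -
  have "\<bar>cut a (\<lambda>u. f (x u)) u\<bar> \<le> B" if "u \<le> t" "-\<tau> \<le> a" for a u
    using bd[of u] that \<open>0 \<le> B\<close> cut_nonneg[OF x that(2), of u] by (auto simp: cut_def)
  then have "\<bar>D1.conv (cut (-\<tau>) (\<lambda>u. f (x u))) t\<bar> \<le> B * D1.mass"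
    "\<bar>D2.conv (cut 0 (\<lambda>u. f (x u))) t\<bar> \<le> B * D2.mass"
    using x tau0 by (auto intro!: D1.conv_bound D2.conv_bound cut_borel)
  then show ?thesis unfolding rhs_def by (simp add: M_def algebra_simps)
qed

lemma rhs_bounded:
  assumes x: "admissible x"
  obtains B where "0 \<le> B" "\<And>t. t \<le> T \<Longrightarrow> rhs x t \<le> B"
proof -
  obtain B where B: "0 \<le> B" "\<And>u. u \<le> T \<Longrightarrow> \<bar>cut (-\<tau>) (\<lambda>u. f (x u)) u\<bar> \<le> B"
    using cut_bounded[OF f_comp_cont[OF x tau0(1)]] by metis
  have "rhs x t \<le> M * B" if "t \<le> T" for t
  proof (rule rhs_le[OF x _ B(1)])
    fix u assume "-\<tau> \<le> u" "u \<le> t"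
    then show "f (x u) \<le> B" using B(2)[of u] that by (auto simp: cut_def)
  qed
  then show ?thesis using that[of "M * B"] B(1) M_pos by simp
qed

lemma rhs_diff:
  assumes x: "admissible x" and y: "admissible y"
    and d: "\<And>u. -\<tau> \<le> u \<Longrightarrow> u \<le> t \<Longrightarrow> \<bar>f (x u) - f (y u)\<bar> \<le> D" and "0 \<le> D"
  shows "\<bar>rhs x t - rhs y t\<bar> \<le> M * D"
proof -
  obtain B where B: "0 \<le> B" "\<And>u. u \<le> t \<Longrightarrow> \<bar>cut (-\<tau>) (\<lambda>u. f (x u)) u\<bar> \<le> B"
    using cut_bounded[OF f_comp_cont[OF x tau0(1)]] by metis
  obtain C where C: "0 \<le> C" "\<And>u. u \<le> t \<Longrightarrow> \<bar>cut (-\<tau>) (\<lambda>u. f (y u)) u\<bar> \<le> C"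
    using cut_bounded[OF f_comp_cont[OF y tau0(1)]] by metis
  have B2: "\<bar>cut 0 (\<lambda>u. f (x u)) u\<bar> \<le> B" if "u \<le> t" for u
    using B(1) B(2)[OF that] tau_pos by (auto simp: cut_def split: if_splits)
  have C2: "\<bar>cut 0 (\<lambda>u. f (y u)) u\<bar> \<le> C" if "u \<le> t" for u
    using C(1) C(2)[OF that] tau_pos by (auto simp: cut_def split: if_splits)
  have "\<bar>cut a (\<lambda>u. f (x u)) u - cut a (\<lambda>u. f (y u)) u\<bar> \<le> D" if "u \<le> t" "-\<tau> \<le> a" for a u
    using d[of u] that \<open>0 \<le> D\<close> by (auto simp: cut_def)
  then have "\<bar>D1.conv (cut (-\<tau>) (\<lambda>u. f (x u))) t - D1.conv (cut (-\<tau>) (\<lambda>u. f (y u))) t\<bar> \<le> D * D1.mass"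
    "\<bar>D2.conv (cut 0 (\<lambda>u. f (x u))) t - D2.conv (cut 0 (\<lambda>u. f (y u))) t\<bar> \<le> D * D2.mass"
    using tau0
    by (intro D1.conv_diff_bound[OF cut_borel[OF x] B(2) cut_borel[OF y] C(2)]
        D2.conv_diff_bound[OF cut_borel[OF x] B2 cut_borel[OF y] C2]; simp)+
  then show ?thesis unfolding rhs_def by (simp add: M_def algebra_simps)
qed

lemma rhs_set_integrable:
  assumes x: "admissible x"
  shows "set_integrable lborel {a..b} (rhs x)"
proof -
  obtain B where "0 \<le> B" "\<And>t. t \<le> b \<Longrightarrow> rhs x t \<le> B" using rhs_bounded[OF x] by blast
  then show ?thesis
    using rhs_nonneg[OF x] by (intro bounded_borel_integrable[OF rhs_borel[OF x], where B = B]) auto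
qed

lemma rhs_integrable: "admissible x \<Longrightarrow> rhs x integrable_on {a..b}"
  by (rule set_borel_integral_eq_integral(1)[OF rhs_set_integrable])

text \<open>A jump requires an atom of one of the measures at the distance from \<open>t\<close> to
  the corresponding cut, and a finite measure has only countably many atoms.\<close>

lemma countable_rhs_discont:
  assumes x: "admissible x"
  shows "countable {t. \<not> isCont (rhs x) t}"
proof -
  have "isCont (rhs x) t" if atoms: "measure \<nu>\<^sub>1 {t - (-\<tau>)} = 0" "measure \<nu>\<^sub>2 {t - 0} = 0" for t
  proof -
    obtain B1 where B1: "0 \<le> B1" "\<And>u. u \<le> t + 1 \<Longrightarrow> \<bar>cut (-\<tau>) (\<lambda>u. f (x u)) u\<bar> \<le> B1"
      using cut_bounded[OF f_comp_cont[OF x tau0(1)]] by metis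
    obtain B2 where B2: "0 \<le> B2" "\<And>u. u \<le> t + 1 \<Longrightarrow> \<bar>cut 0 (\<lambda>u. f (x u)) u\<bar> \<le> B2"
      using cut_bounded[OF f_comp_cont[OF x tau0(2)]] by metis
    have "isCont (D1.conv (cut (-\<tau>) (\<lambda>u. f (x u)))) t"
    proof (rule D1.isCont_conv)
      show "isCont (cut (-\<tau>) (\<lambda>u. f (x u))) u" if "u \<noteq> -\<tau>" for u
        using that by (rule cut_isCont[OF x tau0(1)])
      show "t < t + 1" by simp
    qed (fact cut_borel[OF x tau0(1)] B1(2) atoms)+
    moreover have "isCont (D2.conv (cut 0 (\<lambda>u. f (x u)))) t"
    proof (rule D2.isCont_conv)
      show "isCont (cut 0 (\<lambda>u. f (x u))) u" if "u \<noteq> 0" for u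
        using that by (rule cut_isCont[OF x tau0(2)])
      show "t < t + 1" by simp
    qed (fact cut_borel[OF x tau0(2)] B2(2) atoms)+
    ultimately show ?thesis unfolding rhs_def[abs_def] by (rule isCont_add)
  qed
  then have "{t. \<not> isCont (rhs x) t} \<subseteq> {t. measure \<nu>\<^sub>1 {t - (-\<tau>)} \<noteq> 0} \<union> {t. measure \<nu>\<^sub>2 {t - 0} \<noteq> 0}"
    by blast
  then show ?thesis
    by (rule countable_subset) (intro countable_Un D1.countable_atoms D2.countable_atoms)
qed

lemma picard_history: "-\<tau> \<le> t \<Longrightarrow> t \<le> 0 \<Longrightarrow> picard x t = \<psi> t"
  by (simp add: picard_def)

lemma picard_pos: "0 \<le> t \<Longrightarrow> picard x t = \<psi> 0 + integral {0..t} (rhs x)"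
  by (simp add: picard_def)

lemma picard_ge: "admissible x \<Longrightarrow> 0 \<le> t \<Longrightarrow> \<psi> 0 \<le> picard x t"
  by (simp add: picard_pos Henstock_Kurzweil_Integration.integral_nonneg rhs_integrable rhs_nonneg)

lemma integral_rhs_diff:
  assumes x: "admissible x" and "0 \<le> s" "s \<le> t"
  shows "integral {0..t} (rhs x) - integral {0..s} (rhs x) = integral {s..t} (rhs x)"
  using Henstock_Kurzweil_Integration.integral_combine[OF assms(2,3) rhs_integrable[OF x]] by simp

lemma picard_diff_le:
  assumes x: "admissible x" and "0 \<le> s" "s \<le> t" and B: "\<And>u. u \<le> t \<Longrightarrow> rhs x u \<le> B"
  shows "picard x s \<le> picard x t" "picard x t - picard x s \<le> B * (t - s)"
proof -
  have *: "picard x t - picard x s = integral {s..t} (rhs x)"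
    using integral_rhs_diff[OF assms(1-3)] assms by (simp add: picard_pos)
  have "0 \<le> integral {s..t} (rhs x)"
    by (simp add: Henstock_Kurzweil_Integration.integral_nonneg rhs_integrable rhs_nonneg x)
  moreover have "integral {s..t} (rhs x) \<le> integral {s..t} (\<lambda>_. B)"
    using B by (intro integral_le rhs_integrable[OF x]) auto
  ultimately show "picard x s \<le> picard x t" "picard x t - picard x s \<le> B * (t - s)"
    using * \<open>s \<le> t\<close> by (auto simp: mult.commute)
qed

lemma picard_lipschitz:
  assumes x: "admissible x"
  obtains L where "L-lipschitz_on {0..T} (picard x)"
proof -
  obtain B where B: "0 \<le> B" "\<And>t. t \<le> T \<Longrightarrow> rhs x t \<le> B" using rhs_bounded[OF x] by blast
  have "B-lipschitz_on {0..T} (picard x)"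
  proof (rule lipschitz_on_leI)
    fix s t assume "s \<in> {0..T}" "t \<in> {0..T}" "s \<le> t"
    then show "dist (picard x s) (picard x t) \<le> B * dist s t"
      using picard_diff_le[OF x, of s t B] B(2) by (auto simp: dist_real_def)
  qed (rule B)
  then show ?thesis by (rule that)
qed

lemma picard_admissible:
  assumes x: "admissible x"
  shows "admissible (picard x)"
  unfolding admissible_def
proof (intro conjI allI impI)
  show "continuous_on {-\<tau>..} (picard x)"
  proof (rule continuous_on_atLeastI)
    fix T
    have A: "continuous_on {0..max T 0} (\<lambda>t. integral {0..t} (rhs x))"
      by (rule indefinite_integral_continuous_1[OF rhs_integrable[OF x]])
    have B: "(\<lambda>t. max t 0) ` {-\<tau>..T} \<subseteq> {0..max T 0}" by auto
    have "continuous_on {-\<tau>..T} (\<lambda>t. integral {0..max t 0} (rhs x))"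
      by (rule continuous_on_compose2[OF A _ B]) (intro continuous_intros)
    moreover have C: "(\<lambda>t. min t 0) ` {-\<tau>..T} \<subseteq> {-\<tau>..0}" using tau_pos by auto
    have "continuous_on {-\<tau>..T} (\<lambda>t. \<psi> (min t 0))"
      by (rule continuous_on_compose2[OF \<psi>_cont _ C]) (intro continuous_intros)
    ultimately show "continuous_on {-\<tau>..T} (picard x)"
      unfolding picard_def[abs_def] by (intro continuous_on_add)
  qed
  fix t assume "-\<tau> \<le> t"
  then show "0 \<le> picard x t"
    using picard_ge[OF x, of t] picard_history[of t x] \<psi>_pos[of t] \<psi>_pos[of 0] tau_pos
    by (cases "t \<le> 0") (auto intro: less_imp_le)
qed

text \<open>The weight grows at twice the Lipschitz rate \<open>M * L\<close> of the right-hand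
  side, so integrating it yields the factor 1/2. Delays do no harm, because the weight is increasing
  and earlier arguments are weighted less.\<close>

lemma picard_contraction:
  assumes x: "admissible x" and y: "admissible y"
    and hist: "\<And>u. -\<tau> \<le> u \<Longrightarrow> u \<le> 0 \<Longrightarrow> x u = y u"
    and xR: "\<And>u. -\<tau> \<le> u \<Longrightarrow> u \<le> T \<Longrightarrow> x u \<le> R" and yR: "\<And>u. -\<tau> \<le> u \<Longrightarrow> u \<le> T \<Longrightarrow> y u \<le> R"
    and L: "L-lipschitz_on {0..R} f" "0 < L" and "0 \<le> w"
    and d: "\<And>u. 0 \<le> u \<Longrightarrow> u \<le> T \<Longrightarrow> \<bar>x u - y u\<bar> \<le> w * exp (2 * M * L * u)"
    and t: "0 \<le> t" "t \<le> T"
  shows "\<bar>picard x t - picard y t\<bar> \<le> w / 2 * exp (2 * M * L * t)"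
proof -
  define c where "c = 2 * M * L"
  have c: "0 < c" using M_pos L(2) by (simp add: c_def)
  have diff: "\<bar>rhs x v - rhs y v\<bar> \<le> M * (L * (w * exp (c * v)))" if v: "0 \<le> v" "v \<le> t" for v
  proof (rule rhs_diff[OF x y])
    show "0 \<le> L * (w * exp (c * v))" using L(2) \<open>0 \<le> w\<close> by simp
    fix u assume u: "-\<tau> \<le> u" "u \<le> v"
    show "\<bar>f (x u) - f (y u)\<bar> \<le> L * (w * exp (c * v))"
    proof (cases "u \<le> 0")
      case True
      then show ?thesis using hist[of u] u L(2) \<open>0 \<le> w\<close> by simp
    next
      case False
      have "x u \<in> {0..R}" "y u \<in> {0..R}" using x y xR[of u] yR[of u] u v t by (auto simp: admissible_def)
      then have "\<bar>f (x u) - f (y u)\<bar> \<le> L * \<bar>x u - y u\<bar>"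
        using lipschitz_onD[OF L(1)] by (simp add: dist_real_def)
      also have "\<dots> \<le> L * (w * exp (c * u))"
        using d[of u] False u v t L(2) by (intro mult_left_mono) (auto simp: c_def)
      also have "\<dots> \<le> L * (w * exp (c * v))"
        using L(2) \<open>0 \<le> w\<close> c u by (intro mult_left_mono) auto
      finally show ?thesis .
    qed
  qed
  have hi: "((\<lambda>v. M * (L * (w * exp (c * v)))) has_integral M * (L * (w * ((exp (c * t) - 1) / c)))) {0..t}"
    by (intro has_integral_mult_right has_integral_exp_linear) (use c t in auto)
  have "picard x t - picard y t = integral {0..t} (\<lambda>v. rhs x v - rhs y v)"
    using t x y by (simp add: picard_pos Henstock_Kurzweil_Integration.integral_diff rhs_integrable)
  also have "\<bar>\<dots>\<bar> \<le> integral {0..t} (\<lambda>v. M * (L * (w * exp (c * v))))"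
  proof -
    have "norm (integral {0..t} (\<lambda>v. rhs x v - rhs y v)) \<le> integral {0..t} (\<lambda>v. M * (L * (w * exp (c * v))))"
      using diff hi by (intro integral_norm_bound_integral integrable_diff rhs_integrable x y) auto
    then show ?thesis by simp
  qed
  also have "\<dots> = M * (L * (w * ((exp (c * t) - 1) / c)))" using hi by (rule integral_unique)
  also have "\<dots> = w / 2 * (exp (c * t) - 1)"
    using M_pos L(2) by (simp add: c_def field_simps)
  also have "\<dots> \<le> w / 2 * exp (c * t)" using \<open>0 \<le> w\<close> by (intro mult_left_mono) auto
  finally show ?thesis by (simp add: c_def)
qed

lemma lipschitz_const:
  obtains L where "L-lipschitz_on {0..R} f" "0 < L"
proof -
  obtain L where L: "L-lipschitz_on {0..R} f" using f_lip by blast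
  then have "0 \<le> L" by (rule lipschitz_on_nonneg)
  then show ?thesis using that[of "L + 1"] lipschitz_on_mono[OF L order_refl, of "L + 1"] by simp
qed

text \<open>The weighted distance attains its maximum \<open>w\<close> on \<open>[0, T]\<close> at
  some \<open>t0\<close>; the contraction estimate at \<open>t0\<close> gives
  \<open>w \<le> w / 2\<close>.\<close>

lemma picard_fixed_unique:
  assumes x: "admissible x" "\<And>t. -\<tau> \<le> t \<Longrightarrow> x t = picard x t"
    and y: "admissible y" "\<And>t. -\<tau> \<le> t \<Longrightarrow> y t = picard y t"
    and T: "-\<tau> \<le> T"
  shows "x T = y T"
proof (cases "T \<le> 0")
  case True
  then show ?thesis using x(2)[OF T] y(2)[OF T] picard_history T by simp
next
  case False
  have hist: "x u = y u" if "-\<tau> \<le> u" "u \<le> 0" for u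
    using x(2)[of u] y(2)[of u] picard_history that by simp
  have cx: "continuous_on {-\<tau>..T} x" and cy: "continuous_on {-\<tau>..T} y"
    using x(1) y(1) by (auto simp: admissible_def intro: continuous_on_subset)
  have "bounded (x ` {-\<tau>..T} \<union> y ` {-\<tau>..T})"
    using cx cy by (intro compact_imp_bounded compact_Un compact_continuous_image) auto
  then obtain R where R: "\<And>z. z \<in> x ` {-\<tau>..T} \<union> y ` {-\<tau>..T} \<Longrightarrow> \<bar>z\<bar> \<le> R"
    unfolding bounded_iff by auto
  have xR: "x u \<le> R" "y u \<le> R" if "-\<tau> \<le> u" "u \<le> T" for u
    using R[of "x u"] R[of "y u"] that by auto
  obtain L where L: "L-lipschitz_on {0..R} f" "0 < L" by (rule lipschitz_const)
  define c where "c = 2 * M * L"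
  have "\<exists>t0\<in>{0..T}. \<forall>t\<in>{0..T}. \<bar>x t - y t\<bar> * exp (- c * t) \<le> \<bar>x t0 - y t0\<bar> * exp (- c * t0)"
    using False tau_pos
    by (intro continuous_attains_sup continuous_intros continuous_on_subset[OF cx] continuous_on_subset[OF cy]) auto
  then obtain t0 where t0: "t0 \<in> {0..T}"
    "\<And>t. t \<in> {0..T} \<Longrightarrow> \<bar>x t - y t\<bar> * exp (- c * t) \<le> \<bar>x t0 - y t0\<bar> * exp (- c * t0)" by blast
  define w where "w = \<bar>x t0 - y t0\<bar> * exp (- c * t0)"
  have w0: "0 \<le> w" by (simp add: w_def)
  have d: "\<bar>x u - y u\<bar> \<le> w * exp (c * u)" if "0 \<le> u" "u \<le> T" for u
  proof -
    have "\<bar>x u - y u\<bar> * exp (- c * u) * exp (c * u) \<le> w * exp (c * u)"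
      using t0(2)[of u] that by (intro mult_right_mono) (auto simp: w_def)
    then show ?thesis by (simp add: mult.assoc flip: exp_add)
  qed
  have "\<bar>picard x t0 - picard y t0\<bar> \<le> w / 2 * exp (2 * M * L * t0)"
    by (rule picard_contraction[OF x(1) y(1) hist xR L w0]) (use d t0(1) in \<open>auto simp: c_def\<close>)
  moreover have "picard x t0 = x t0" "picard y t0 = y t0" using x(2)[of t0] y(2)[of t0] t0(1) tau_pos by auto
  ultimately have "\<bar>x t0 - y t0\<bar> * exp (- c * t0) \<le> (w / 2 * exp (c * t0)) * exp (- c * t0)"
    by (intro mult_right_mono) (auto simp: c_def)
  then have "w \<le> w / 2 * (exp (c * t0) * exp (- c * t0))" by (simp only: w_def mult.assoc)
  then have "w \<le> w / 2" by (simp flip: exp_add)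
  then have "w = 0" using w0 by simp
  then show ?thesis using d[of T] False by simp
qed

text \<open>An exponential bound that is invariant under the Picard map; all iterates below it take
  values, on each bounded time interval, in one compact set on which \<open>f\<close> is Lipschitz.\<close>

lemma picard_exp_bound:
  assumes x: "admissible x" and K: "0 < K" "\<And>u. 0 \<le> u \<Longrightarrow> f u \<le> K * (1 + u)"
    and R: "1 \<le> R" "\<And>t. t \<in> {-\<tau>..0} \<Longrightarrow> 2 * \<psi> t \<le> R"
    and bd: "\<And>u. -\<tau> \<le> u \<Longrightarrow> x u \<le> R * exp (4 * M * K * max u 0)" and t: "-\<tau> \<le> t"
  shows "picard x t \<le> R * exp (4 * M * K * max t 0)"
proof (cases "t \<le> 0")
  case True
  then show ?thesis using picard_history[of t x] R(2)[of t] t \<psi>_pos[of t] by simp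
next
  case False
  \<comment> \<open>With \<open>1 \<le> R\<close> absorbing the constant in \<open>1 + u\<close>,
    the right-hand side is at most \<open>2 * M * K * R\<close> times the exponential. The rate
    \<open>4 * M * K\<close> turns its integral into half of \<open>R\<close>, and the other half
    pays for \<open>\<psi> 0\<close>.\<close>
  define c where "c = 4 * M * K"
  have c: "0 < c" using M_pos K(1) by (simp add: c_def)
  have le: "rhs x v \<le> M * (K * (2 * R * exp (c * v)))" if "0 \<le> v" for v
  proof (rule rhs_le[OF x])
    show "0 \<le> K * (2 * R * exp (c * v))" using K(1) R(1) by simp
    fix u assume u: "-\<tau> \<le> u" "u \<le> v"
    have "f (x u) \<le> K * (1 + x u)" using x u by (intro K) (auto simp: admissible_def)
    also have "\<dots> \<le> K * (2 * R * exp (c * v))"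
    proof (rule mult_left_mono)
      have "x u \<le> R * exp (c * max u 0)" using bd[OF u(1)] by (simp add: c_def)
      also have "\<dots> \<le> R * exp (c * v)" using R(1) c u that by (intro mult_left_mono) auto
      finally have "x u \<le> R * exp (c * v)" .
      moreover have "1 * 1 \<le> R * exp (c * v)" using R(1) c that by (intro mult_mono) auto
      ultimately show "1 + x u \<le> 2 * R * exp (c * v)" by simp
    qed (use K in auto)
    finally show "f (x u) \<le> K * (2 * R * exp (c * v))" .
  qed
  have hi: "((\<lambda>v. M * (K * (2 * R * exp (c * v)))) has_integral M * (K * (2 * R * ((exp (c * t) - 1) / c)))) {0..t}"
    by (intro has_integral_mult_right has_integral_exp_linear) (use c False in auto)
  have "integral {0..t} (rhs x) \<le> integral {0..t} (\<lambda>v. M * (K * (2 * R * exp (c * v))))"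
    using le hi by (intro integral_le rhs_integrable[OF x]) auto
  also have "\<dots> = M * (K * (2 * R * ((exp (c * t) - 1) / c)))" using hi by (rule integral_unique)
  also have "\<dots> = R / 2 * (exp (c * t) - 1)" using M_pos K(1) by (simp add: c_def field_simps)
  finally have "picard x t \<le> \<psi> 0 + R / 2 * (exp (c * t) - 1)" using False by (simp add: picard_pos)
  also have "\<dots> \<le> R / 2 * exp (c * t)" using R(2)[of 0] tau_pos by (simp add: algebra_simps)
  also have "\<dots> \<le> R * exp (c * t)" using R(1) by simp
  finally show ?thesis using False by (simp add: c_def)
qed

section \<open>Picard iteration and its limit\<close>

primrec iterate :: "nat \<Rightarrow> real \<Rightarrow> real" where
  "iterate 0 = (\<lambda>t. \<psi> (min t 0))"
| "iterate (Suc n) = picard (iterate n)"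

lemma iterate_history: "-\<tau> \<le> t \<Longrightarrow> t \<le> 0 \<Longrightarrow> iterate n t = \<psi> t"
  by (cases n) (auto simp: picard_history)

lemma iterate_admissible: "admissible (iterate n)"
proof (induction n)
  case 0
  have "(\<lambda>t. min t 0) ` {-\<tau>..} \<subseteq> {-\<tau>..0}" using tau_pos by auto
  then have "continuous_on {-\<tau>..} (iterate 0)"
    unfolding iterate.simps by (rule continuous_on_compose2[OF \<psi>_cont, rotated]) (intro continuous_intros)
  moreover have "0 \<le> iterate 0 t" if "-\<tau> \<le> t" for t
    using \<psi>_pos[of t] \<psi>_pos[of 0] that tau_pos by (auto simp: min_def less_imp_le)
  ultimately show ?case by (simp add: admissible_def)
qed (simp add: picard_admissible)

text \<open>The common bound \<open>b\<close> keeps all iterates up to time \<open>T\<close> in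
  \<open>[0, b T]\<close>, so a single Lipschitz constant serves them. This constant depends on
  \<open>T\<close>, hence convergence is uniform on bounded intervals only, which suffices for
  continuity of the limit and for passing to the limit in the Picard map.\<close>

lemma picard_fixed_exists:
  obtains x where "admissible x" "\<And>t. -\<tau> \<le> t \<Longrightarrow> x t = picard x t"
proof -
  obtain K where K: "0 < K" "\<And>u. 0 \<le> u \<Longrightarrow> f u \<le> K * (1 + u)" using f_growth by blast
  have "bounded (\<psi> ` {-\<tau>..0})" by (intro compact_imp_bounded compact_continuous_image \<psi>_cont) auto
  then obtain R0 where R0: "\<forall>t\<in>{-\<tau>..0}. \<bar>\<psi> t\<bar> \<le> R0" unfolding bounded_iff by auto
  define R where "R = max 1 (2 * R0)"
  have R: "1 \<le> R" "\<And>t. t \<in> {-\<tau>..0} \<Longrightarrow> 2 * \<psi> t \<le> R" using R0 by (force simp: R_def)+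
  define b where "b t = R * exp (4 * M * K * max t 0)" for t
  have bmono: "b s \<le> b t" if "s \<le> t" for s t
    using that R(1) M_pos K(1) by (auto simp: b_def intro!: mult_left_mono)
  have itb: "iterate n t \<le> b t" if "-\<tau> \<le> t" for n t
    using that
  proof (induction n arbitrary: t)
    case 0
    have "iterate 0 t = \<psi> (min t 0)" "min t 0 \<in> {-\<tau>..0}" using 0 tau_pos by auto
    then have "iterate 0 t * 1 \<le> R * exp (4 * M * K * max t 0)"
      using R(1) R(2)[of "min t 0"] \<psi>_pos[of "min t 0"] M_pos K(1) by (intro mult_mono) auto
    then show ?case by (simp add: b_def)
  next
    case (Suc n)
    have "picard (iterate n) t \<le> R * exp (4 * M * K * max t 0)"
      by (rule picard_exp_bound[OF iterate_admissible K R]) (use Suc in \<open>auto simp: b_def\<close>)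
    then show ?case by (simp add: b_def)
  qed
  have geom: "\<exists>C. \<forall>n. \<forall>t\<in>{-\<tau>..T}. \<bar>iterate (Suc n) t - iterate n t\<bar> \<le> C * (1/2) ^ n" for T
  proof -
    obtain L where L: "L-lipschitz_on {0..b T} f" "0 < L" by (rule lipschitz_const)
    define c where "c = 2 * M * L"
    have c: "0 < c" using L M_pos by (simp add: c_def)
    have bT: "0 < b T" using R(1) by (simp add: b_def)
    have le: "iterate n u \<le> b T" if "-\<tau> \<le> u" "u \<le> T" for n u
      using itb[OF that(1), of n] bmono[OF that(2)] by linarith
    have "\<bar>iterate (Suc n) t - iterate n t\<bar> \<le> b T * (1/2) ^ n * exp (c * t)" if "0 \<le> t" "t \<le> T" for n t
      using that
    proof (induction n arbitrary: t)
      \<comment> \<open>Both iterates lie in \<open>[0, b T]\<close> and the weight is at least 1,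
        so \<open>b T\<close> serves as initial weighted distance.\<close>
      case 0
      have "-\<tau> \<le> t" using 0 tau_pos by simp
      then have "iterate 0 t \<in> {0..b T}" "iterate (Suc 0) t \<in> {0..b T}"
        using le[of t] 0 iterate_admissible unfolding admissible_def by (auto simp del: iterate.simps)
      then have "\<bar>iterate (Suc 0) t - iterate 0 t\<bar> \<le> b T * 1" by (auto simp del: iterate.simps simp: abs_le_iff)
      also have "\<dots> \<le> b T * exp (c * t)" using bT c 0 by (intro mult_left_mono) auto
      finally show ?case by simp
    next
      case (Suc n)
      have "\<bar>picard (iterate (Suc n)) t - picard (iterate n) t\<bar> \<le> (b T * (1/2) ^ n) / 2 * exp (2 * M * L * t)"
        by (rule picard_contraction[OF iterate_admissible iterate_admissible _ le le L])
          (use Suc bT iterate_history in \<open>auto simp: c_def simp del: iterate.simps\<close>)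
      then show ?case by (simp add: c_def mult_ac)
    qed note 1 = this
    have "\<bar>iterate (Suc n) t - iterate n t\<bar> \<le> (b T * exp (c * max T 0)) * (1/2) ^ n" if "t \<in> {-\<tau>..T}" for n t
    proof (cases "t \<le> 0")
      case True
      then show ?thesis using that iterate_history[of t] bT by (simp del: iterate.simps)
    next
      case False
      then have "\<bar>iterate (Suc n) t - iterate n t\<bar> \<le> b T * (1/2) ^ n * exp (c * t)" using 1 that by auto
      also have "\<dots> \<le> b T * (1/2) ^ n * exp (c * max T 0)"
        using bT c that by (intro mult_left_mono) auto
      finally show ?thesis by (simp add: mult_ac)
    qed
    then show ?thesis using bT by (intro exI[of _ "b T * exp (c * max T 0)"]) auto
  qed
  \<comment> \<open>A telescoping series, so that the limit is one function independent of
    \<open>T\<close>.\<close>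
  define x where "x t = iterate 0 t + (\<Sum>i. iterate (Suc i) t - iterate i t)" for t
  have ul: "uniform_limit {-\<tau>..T} iterate x sequentially" for T
  proof -
    obtain C where C: "\<And>n t. t \<in> {-\<tau>..T} \<Longrightarrow> \<bar>iterate (Suc n) t - iterate n t\<bar> \<le> C * (1/2) ^ n"
      using geom[of T] by blast
    have "uniform_limit {-\<tau>..T} (\<lambda>n t. \<Sum>i<n. iterate (Suc i) t - iterate i t)
        (\<lambda>t. \<Sum>i. iterate (Suc i) t - iterate i t) sequentially"
      by (rule Weierstrass_m_test[where M = "\<lambda>n. C * (1/2) ^ n"])
         (use C in \<open>auto intro!: summable_mult simp del: iterate.simps\<close>)
    then have "uniform_limit {-\<tau>..T} (\<lambda>n t. iterate 0 t + (\<Sum>i<n. iterate (Suc i) t - iterate i t)) x sequentially"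
      unfolding x_def by (intro uniform_limit_intros)
    moreover have "iterate 0 t + (\<Sum>i<n. iterate (Suc i) t - iterate i t) = iterate n t" for n t
      using sum_lessThan_telescope[of "\<lambda>i. iterate i t" n] by (simp del: iterate.simps)
    ultimately show ?thesis by simp
  qed
  have lim: "(\<lambda>n. iterate n t) \<longlonglongrightarrow> x t" if "-\<tau> \<le> t" for t
    using tendsto_uniform_limitI[OF ul[of t], of t] that by simp
  have xb: "x t \<le> b t" if "-\<tau> \<le> t" for t
    by (rule LIMSEQ_le_const2[OF lim[OF that]]) (use itb[OF that] in auto)
  have x0: "0 \<le> x t" if "-\<tau> \<le> t" for t
    by (rule LIMSEQ_le_const[OF lim[OF that]]) (use iterate_admissible that in \<open>auto simp: admissible_def\<close>)
  have "continuous_on {-\<tau>..} x"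
  proof (rule continuous_on_atLeastI)
    fix T
    have "continuous_on {-\<tau>..T} (iterate n)" for n
      using iterate_admissible[of n] by (auto simp: admissible_def intro: continuous_on_subset)
    then show "continuous_on {-\<tau>..T} x"
      by (intro uniform_limit_theorem[OF _ ul]) auto
  qed
  then have x: "admissible x" using x0 by (simp add: admissible_def)
  have hist: "x t = \<psi> t" if "-\<tau> \<le> t" "t \<le> 0" for t
    using LIMSEQ_unique[OF lim[OF that(1)]] iterate_history[OF that] by simp
  have "x t = picard x t" if t: "-\<tau> \<le> t" for t
  proof (cases "t \<le> 0")
    case True then show ?thesis using hist t picard_history by simp
  next
    case False
    obtain L where L: "L-lipschitz_on {0..b t} f" "0 < L" by (rule lipschitz_const)
    define E where "E = exp (2 * M * L * t)"
    have "(\<lambda>n. picard (iterate n) t) \<longlonglongrightarrow> picard x t"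
    proof (rule LIMSEQ_I)
      fix e :: real assume "e > 0"
      \<comment> \<open>Dividing by the weight at \<open>t\<close> makes the contraction bound there
        equal to \<open>e / 2\<close>.\<close>
      define w where "w = e / E"
      have w: "w > 0" "w * E = e" using \<open>e > 0\<close> by (auto simp: w_def E_def)
      obtain N where N: "\<And>n u. n \<ge> N \<Longrightarrow> u \<in> {-\<tau>..t} \<Longrightarrow> \<bar>iterate n u - x u\<bar> < w"
        using ul[of t] w(1) unfolding uniform_limit_sequentially_iff dist_real_def by blast
      have "norm (picard (iterate n) t - picard x t) < e" if n: "n \<ge> N" for n
      proof -
        have "\<bar>picard (iterate n) t - picard x t\<bar> \<le> w / 2 * exp (2 * M * L * t)"
        proof (rule picard_contraction[OF iterate_admissible x _ _ _ L])
          show "iterate n u = x u" if "-\<tau> \<le> u" "u \<le> 0" for u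
            using hist[OF that] iterate_history[OF that] by simp
          show "iterate n u \<le> b t" "x u \<le> b t" if "-\<tau> \<le> u" "u \<le> t" for u
            using itb[OF that(1), of n] xb[OF that(1)] bmono[OF that(2)] by linarith+
          show "\<bar>iterate n u - x u\<bar> \<le> w * exp (2 * M * L * u)" if u: "0 \<le> u" "u \<le> t" for u
          proof -
            have "\<bar>iterate n u - x u\<bar> \<le> w * 1" using N[OF n, of u] u tau_pos by simp
            also have "\<dots> \<le> w * exp (2 * M * L * u)"
              using w(1) M_pos L(2) u by (intro mult_left_mono) auto
            finally show ?thesis .
          qed
        qed (use w False in auto)
        also have "\<dots> = e / 2" using w(2) by (simp add: E_def)
        finally show ?thesis using \<open>e > 0\<close> by simp
      qed
      then show "\<exists>N. \<forall>n\<ge>N. norm (picard (iterate n) t - picard x t) < e" by blast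
    qed
    then have "(\<lambda>n. iterate (Suc n) t) \<longlonglongrightarrow> picard x t" by simp
    then have "(\<lambda>n. iterate n t) \<longlonglongrightarrow> picard x t" by (rule LIMSEQ_imp_Suc)
    then show ?thesis using lim[OF t] LIMSEQ_unique by blast
  qed
  with x show ?thesis using that by blast
qed

section \<open>Fixed points and solutions of the differential equation\<close>

lemma picard_deriv:
  assumes x: "admissible x" and t: "0 < t" and c: "isCont (rhs x) t"
  shows "(picard x has_real_derivative rhs x t) (at t)"
proof -
  have "((\<lambda>u. integral {0..u} (rhs x)) has_vector_derivative rhs x t) (at t within ({0..t + 1} - {}))"
    using t c by (intro integral_has_vector_derivative_continuous_at rhs_integrable[OF x])
      (auto intro: continuous_within_subset)
  moreover have "at t within {0..t + 1} = at t" using t by (intro at_within_Icc_at) auto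
  ultimately have "((\<lambda>u. integral {0..u} (rhs x)) has_real_derivative rhs x t) (at t)"
    by (simp add: has_real_derivative_iff_has_vector_derivative)
  then have D: "((\<lambda>u. \<psi> 0 + integral {0..u} (rhs x)) has_real_derivative rhs x t) (at t)"
    by (auto intro!: derivative_eq_intros)
  have "eventually (\<lambda>u. 0 < u) (nhds t)" using t by (rule order_tendstoD[OF filterlim_ident])
  then have "eventually (\<lambda>u. picard x u = \<psi> 0 + integral {0..u} (rhs x)) (nhds t)"
    by eventually_elim (simp add: picard_pos)
  from DERIV_cong_ev[OF refl this refl] D show ?thesis by simp
qed

text \<open>From left to right the fundamental theorem for absolutely continuous functions
  integrates the equation. Conversely a fixed point is Lipschitz on bounded intervals, and
  differentiable wherever the right-hand side is continuous. The original measures appear only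
  through \<open>rhs_eq\<close>, since the locale knows just their images on the line.\<close>

lemma is_solution_iff:
  assumes rhs_eq: "\<And>x t. admissible x \<Longrightarrow> 0 < t \<Longrightarrow>
      rhs x t = (LINT s:{0..\<tau>}|\<mu>\<^sub>1. f (x (t - s))) + (LINT s:{0..t}|\<mu>\<^sub>2. f (x (t - s)))"
  shows "is_solution \<tau> \<mu>\<^sub>1 \<mu>\<^sub>2 f \<psi> x \<longleftrightarrow> admissible x \<and> (\<forall>t\<ge>-\<tau>. x t = picard x t)"
proof (intro iffI conjI)
  assume sol: "is_solution \<tau> \<mu>\<^sub>1 \<mu>\<^sub>2 f \<psi> x"
  then show x: "admissible x" by (simp add: is_solution_def admissible_def)
  have der: "AE t in lebesgue. 0 < t \<longrightarrow> (x has_real_derivative rhs x t) (at t)"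
    using sol rhs_eq[OF x] unfolding is_solution_def by (auto elim!: eventually_mono)
  have hist: "x t = \<psi> t" if "-\<tau> \<le> t" "t \<le> 0" for t
    using sol that by (auto simp: is_solution_def)
  show "\<forall>t\<ge>-\<tau>. x t = picard x t"
  proof (intro allI impI)
    fix t assume t: "-\<tau> \<le> t"
    show "x t = picard x t"
    proof (cases "t \<le> 0")
      case True
      then show ?thesis using hist t picard_history by simp
    next
      case False
      have "absolutely_continuous_on {0..t} x"
        using sol by (auto simp: is_solution_def locally_absolutely_continuous_on_def)
      moreover have "AE s in lebesgue. s \<in> {0<..<t} \<longrightarrow> (x has_real_derivative rhs x s) (at s)"
        using der by eventually_elim auto
      ultimately have "(rhs x has_integral (x t - x 0)) {0..t}"
        using False by (intro absolutely_continuous_on_FTC) auto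
      then have "integral {0..t} (rhs x) = x t - x 0" by (rule integral_unique)
      then show ?thesis using False hist[of 0] tau_pos by (simp add: picard_pos)
    qed
  qed
next
  assume "admissible x \<and> (\<forall>t\<ge>-\<tau>. x t = picard x t)"
  then have x: "admissible x" and fx: "\<And>t. -\<tau> \<le> t \<Longrightarrow> x t = picard x t" by auto
  have ac: "locally_absolutely_continuous_on {0..} x"
    unfolding locally_absolutely_continuous_on_def
  proof (intro allI impI)
    fix a b :: real assume ab: "{a..b} \<subseteq> {0..}"
    obtain L where L: "L-lipschitz_on {0..b} (picard x)" using picard_lipschitz[OF x] .
    have "{a..b} \<subseteq> {0..b}" using ab by auto
    then have "L-lipschitz_on {a..b} (picard x)" by (rule lipschitz_on_subset[OF L])
    moreover have "x t = picard x t" if "t \<in> {a..b}" for t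
      using that ab tau_pos by (intro fx) (auto simp: subset_eq dest!: bspec)
    ultimately have "L-lipschitz_on {a..b} x" by (simp add: lipschitz_on_def)
    then show "absolutely_continuous_on {a..b} x" by (rule lipschitz_imp_absolutely_continuous_on)
  qed
  have "{t. \<not> isCont (rhs x) t} \<in> null_sets lebesgue"
    by (intro null_sets_completionI countable_imp_null_set_lborel countable_rhs_discont[OF x])
  from AE_not_in[OF this]
  have "AE t in lebesgue. 0 < t \<longrightarrow> (x has_real_derivative
      (LINT s:{0..\<tau>}|\<mu>\<^sub>1. f (x (t - s))) + (LINT s:{0..t}|\<mu>\<^sub>2. f (x (t - s)))) (at t)"
  proof eventually_elim
    case (elim t)
    show ?case
    proof
      assume t: "0 < t"
      have "eventually (\<lambda>u. 0 < u) (nhds t)" using t by (rule order_tendstoD[OF filterlim_ident])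
      then have "eventually (\<lambda>u. x u = picard x u) (nhds t)"
        by eventually_elim (use tau_pos in \<open>auto intro: fx\<close>)
      from DERIV_cong_ev[OF refl this refl] picard_deriv[OF x t] elim
      have "(x has_real_derivative rhs x t) (at t)" by simp
      then show "(x has_real_derivative
          (LINT s:{0..\<tau>}|\<mu>\<^sub>1. f (x (t - s))) + (LINT s:{0..t}|\<mu>\<^sub>2. f (x (t - s)))) (at t)"
        using rhs_eq[OF x t] by simp
    qed
  qed
  then show "is_solution \<tau> \<mu>\<^sub>1 \<mu>\<^sub>2 f \<psi> x"
    using x ac fx picard_history unfolding is_solution_def admissible_def by auto
qed

end

section \<open>Asymptotics\<close>

context delay_measure
begin

lemma tendsto_measure_Icc: "(\<lambda>n. measure \<nu> {0..real n}) \<longlonglongrightarrow> mass"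
proof -
  have "(\<lambda>n. measure \<nu> {0..real n}) \<longlonglongrightarrow> measure \<nu> (\<Union>n. {0..real n})"
    by (intro finite_Lim_measure_incseq) (auto simp: sets_borel incseq_def)
  moreover have "(\<Union>n. {0..real n}) = {0..}" by (auto intro: real_arch_simple)
  moreover have "measure \<nu> {0..} = mass"
    using AE_nonneg by (intro measure_eq_AE) (auto simp: sets_borel)
  ultimately show ?thesis by simp
qed

end

context delay_equation
begin

lemma convs_integrable:
  assumes x: "admissible x"
  shows "D1.conv (cut (-\<tau>) (\<lambda>u. f (x u))) integrable_on {a..b}"
    and "D2.conv (cut 0 (\<lambda>u. f (x u))) integrable_on {a..b}"
proof -
  obtain B where B: "\<forall>u\<le>b. \<bar>cut (-\<tau>) (\<lambda>u. f (x u)) u\<bar> \<le> B"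
    using cut_bounded[OF f_comp_cont[OF x tau0(1)]] by metis
  have "set_integrable lborel {a..b} (D1.conv (cut (-\<tau>) (\<lambda>u. f (x u))))"
  proof (rule bounded_borel_integrable)
    show "\<bar>D1.conv (cut (-\<tau>) (\<lambda>u. f (x u))) t\<bar> \<le> B * D1.mass" if "t \<in> {a..b}" for t
      using B that by (intro D1.conv_bound cut_borel x tau0) auto
  qed (intro D1.borel_measurable_conv cut_borel x tau0)
  then show "D1.conv (cut (-\<tau>) (\<lambda>u. f (x u))) integrable_on {a..b}"
    by (rule set_borel_integral_eq_integral)
  obtain C where C: "\<forall>u\<le>b. \<bar>cut 0 (\<lambda>u. f (x u)) u\<bar> \<le> C"
    using cut_bounded[OF f_comp_cont[OF x tau0(2)]] by metis
  have "set_integrable lborel {a..b} (D2.conv (cut 0 (\<lambda>u. f (x u))))"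
  proof (rule bounded_borel_integrable)
    show "\<bar>D2.conv (cut 0 (\<lambda>u. f (x u))) t\<bar> \<le> C * D2.mass" if "t \<in> {a..b}" for t
      using C that by (intro D2.conv_bound cut_borel x tau0) auto
  qed (intro D2.borel_measurable_conv cut_borel x tau0)
  then show "D2.conv (cut 0 (\<lambda>u. f (x u))) integrable_on {a..b}"
    by (rule set_borel_integral_eq_integral)
qed

section \<open>Bounds of the Picard map by the undelayed integral\<close>

definition total :: "(real \<Rightarrow> real) \<Rightarrow> real \<Rightarrow> real" where
  "total x t = integral {0..t} (\<lambda>u. f (x u))"

lemma f_comp_integrable:
  assumes "admissible x" "-\<tau> \<le> a"
  shows "(\<lambda>u. f (x u)) integrable_on {a..b}"
  by (intro integrable_continuous_real continuous_on_subset[OF f_comp_cont[OF assms]]) auto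

lemma picard_total_le:
  assumes x: "admissible x"
  shows "\<exists>C. \<forall>t\<ge>0. picard x t \<le> C + M * total x t"
\<comment> \<open>The witness stays schematic until the last line: \<open>\<psi> 0\<close> plus the
  first mass times the integral over the history, independent of \<open>t\<close>. The bounds
  \<open>B\<close> and \<open>C\<close> do depend on \<open>t\<close> but leave no trace in the
  result.\<close>
proof (intro exI allI impI)
  fix t :: real assume t: "0 \<le> t"
  let ?h1 = "cut (-\<tau>) (\<lambda>u. f (x u))" and ?h2 = "cut 0 (\<lambda>u. f (x u))"
  obtain B where B: "\<forall>u\<le>t. \<bar>?h1 u\<bar> \<le> B"
    using cut_bounded[OF f_comp_cont[OF x tau0(1)]] by metis
  obtain C where C: "\<forall>u\<le>t. \<bar>?h2 u\<bar> \<le> C"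
    using cut_bounded[OF f_comp_cont[OF x tau0(2)]] by metis
  have "integral {0..t} (rhs x) = integral {0..t} (D1.conv ?h1) + integral {0..t} (D2.conv ?h2)"
    unfolding rhs_def[abs_def] by (rule Henstock_Kurzweil_Integration.integral_add[OF convs_integrable[OF x]])
  also have "integral {0..t} (D1.conv ?h1) \<le> D1.mass * integral {-\<tau>..t} ?h1"
  proof (rule D1.integral_conv_le[OF cut_borel[OF x tau0(1)]])
    show "?h1 u \<le> B" if "u \<le> t" for u using B that by (auto simp: abs_le_iff)
    show "0 \<le> ?h1 u" for u by (rule cut_nonneg[OF x tau0(1)])
  qed (use t tau_pos in \<open>auto simp: cut_def\<close>)
  also have "integral {-\<tau>..t} ?h1 = integral {-\<tau>..t} (\<lambda>u. f (x u))"
    by (intro integral_cong) (auto simp: cut_def)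
  also have "\<dots> = integral {-\<tau>..0} (\<lambda>u. f (x u)) + total x t"
    unfolding total_def using t tau_pos
    by (intro Henstock_Kurzweil_Integration.integral_combine[symmetric] f_comp_integrable[OF x]) auto
  also have "integral {0..t} (D2.conv ?h2) \<le> D2.mass * integral {0..t} ?h2"
  proof (rule D2.integral_conv_le[OF cut_borel[OF x tau0(2)]])
    show "?h2 u \<le> C" if "u \<le> t" for u using C that by (auto simp: abs_le_iff)
    show "0 \<le> ?h2 u" for u by (rule cut_nonneg[OF x tau0(2)])
  qed (use t in \<open>auto simp: cut_def\<close>)
  also have "integral {0..t} ?h2 = total x t"
    unfolding total_def by (intro integral_cong) (auto simp: cut_def)
  finally show "picard x t \<le> (\<psi> 0 + D1.mass * integral {-\<tau>..0} (\<lambda>u. f (x u))) + M * total x t"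
    using t by (simp add: picard_pos M_def algebra_simps)
qed

lemma picard_total_ge:
  assumes x: "admissible x" and S: "0 \<le> S" "S \<le> t"
  shows "(measure \<nu>\<^sub>1 {0..S} + measure \<nu>\<^sub>2 {0..S}) * total x (t - S) \<le> picard x t"
proof -
  let ?h1 = "cut (-\<tau>) (\<lambda>u. f (x u))" and ?h2 = "cut 0 (\<lambda>u. f (x u))"
  obtain B where B: "\<forall>u\<le>t. \<bar>?h1 u\<bar> \<le> B"
    using cut_bounded[OF f_comp_cont[OF x tau0(1)]] by metis
  obtain C where C: "\<forall>u\<le>t. \<bar>?h2 u\<bar> \<le> C"
    using cut_bounded[OF f_comp_cont[OF x tau0(2)]] by metis
  have e1: "integral {0..t - S} ?h1 = total x (t - S)"
    unfolding total_def using tau_pos by (intro integral_cong) (auto simp: cut_def)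
  have e2: "integral {0..t - S} ?h2 = total x (t - S)"
    unfolding total_def by (intro integral_cong) (auto simp: cut_def)
  have "measure \<nu>\<^sub>1 {0..S} * integral {0..t - S} ?h1 \<le> integral {0..t} (D1.conv ?h1)"
  proof (rule D1.integral_conv_ge[OF cut_borel[OF x tau0(1)]])
    show "?h1 u \<le> B" if "u \<le> t" for u using B that by (auto simp: abs_le_iff)
    show "0 \<le> ?h1 u" for u by (rule cut_nonneg[OF x tau0(1)])
    show "?h1 u = 0" if "u < -\<tau>" for u using that by (simp add: cut_def)
  qed (use S tau_pos in auto)
  moreover have "measure \<nu>\<^sub>2 {0..S} * integral {0..t - S} ?h2 \<le> integral {0..t} (D2.conv ?h2)"
  proof (rule D2.integral_conv_ge[OF cut_borel[OF x tau0(2)]])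
    show "?h2 u \<le> C" if "u \<le> t" for u using C that by (auto simp: abs_le_iff)
    show "0 \<le> ?h2 u" for u by (rule cut_nonneg[OF x tau0(2)])
    show "?h2 u = 0" if "u < 0" for u using that by (simp add: cut_def)
  qed (use S in auto)
  moreover have "integral {0..t} (rhs x) = integral {0..t} (D1.conv ?h1) + integral {0..t} (D2.conv ?h2)"
    unfolding rhs_def[abs_def] by (rule Henstock_Kurzweil_Integration.integral_add[OF convs_integrable[OF x]])
  moreover have "0 < \<psi> 0" using \<psi>_pos[of 0] tau_pos by simp
  ultimately show ?thesis using S by (simp add: picard_pos e1 e2 distrib_right)
qed

text \<open>Continuity from below of the measures: all but an arbitrarily small part of the mass has
  a bounded lag.\<close>

lemma mass_below:
  assumes "a < M"
  obtains S where "0 \<le> S" "a < measure \<nu>\<^sub>1 {0..S} + measure \<nu>\<^sub>2 {0..S}"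
proof -
  have "(\<lambda>n. measure \<nu>\<^sub>1 {0..real n} + measure \<nu>\<^sub>2 {0..real n}) \<longlonglongrightarrow> M"
    unfolding M_def by (intro tendsto_add D1.tendsto_measure_Icc D2.tendsto_measure_Icc)
  from order_tendstoD(1)[OF this assms] obtain n where
    "a < measure \<nu>\<^sub>1 {0..real n} + measure \<nu>\<^sub>2 {0..real n}" by (auto simp: eventually_sequentially)
  then show ?thesis by (intro that[of "real n"]) auto
qed

section \<open>Growth of a fixed point\<close>

context
  fixes x :: "real \<Rightarrow> real"
  assumes x: "admissible x" and fixed: "\<And>t. -\<tau> \<le> t \<Longrightarrow> x t = picard x t"
begin

lemma fixed_pos: "0 \<le> t \<Longrightarrow> x t = picard x t"
  using fixed[of t] tau_pos by simp

lemma solution_mono: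
  assumes "0 \<le> s" "s \<le> t"
  shows "x s \<le> x t"
proof -
  obtain B where "\<And>u. u \<le> t \<Longrightarrow> rhs x u \<le> B" using rhs_bounded[OF x] by metis
  from picard_diff_le(1)[OF x assms this] show ?thesis using assms fixed_pos by simp
qed

lemma total_deriv:
  assumes "0 < t"
  shows "(total x has_real_derivative f (x t)) (at t)"
proof -
  have "((\<lambda>t. integral {0..t} (\<lambda>u. f (x u))) has_real_derivative f (x t)) (at t within {0..t + 1})"
    using assms
    by (intro integral_has_real_derivative continuous_on_subset[OF f_comp_cont[OF x tau0(2)]]) auto
  moreover have "at t within {0..t + 1} = at t" using assms by (intro at_within_Icc_at) auto
  ultimately show ?thesis by (simp add: total_def[abs_def])
qed

text \<open>A monotone solution that does not diverge stays below some \<open>Z\<close>; there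
  \<open>f\<close> has a positive minimum, so \<open>total\<close> grows linearly, and the lower
  bound with lag \<open>S\<close> pushes the solution past \<open>Z\<close>.\<close>

lemma solution_at_top: "filterlim x at_top at_top"
proof (rule ccontr)
  assume "\<not> ?thesis"
  then obtain Z where Z: "\<not> eventually (\<lambda>t. Z \<le> x t) at_top" by (auto simp: filterlim_at_top)
  have lt: "x t < Z" if "0 \<le> t" for t
  proof (rule ccontr)
    assume "\<not> x t < Z"
    then have "Z \<le> x u" if "u \<ge> t" for u using solution_mono[OF \<open>0 \<le> t\<close> that] by linarith
    then show False using Z by (auto simp: eventually_at_top_linorder)
  qed
  have Z0: "0 \<le> Z" using lt[of 0] x tau_pos by (auto simp: admissible_def dest!: spec[of _ 0])
  have "\<exists>v\<in>{0..Z}. \<forall>u\<in>{0..Z}. f v \<le> f u"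
    using Z0 by (intro continuous_attains_inf continuous_on_subset[OF f_cont]) auto
  then obtain c where c: "0 < c" "\<And>u. 0 \<le> u \<Longrightarrow> u \<le> Z \<Longrightarrow> c \<le> f u"
    using f_pos by (metis atLeastAtMost_iff)
  have ge: "c * t \<le> total x t" if "0 \<le> t" for t
  proof -
    have "integral {0..t} (\<lambda>_. c) \<le> total x t"
      unfolding total_def
    proof (intro integral_le f_comp_integrable[OF x])
      fix u assume "u \<in> {0..t}"
      then show "c \<le> f (x u)" using lt[of u] x tau_pos by (intro c) (auto simp: admissible_def)
    qed (use tau_pos in auto)
    then show ?thesis using that by (simp add: mult.commute)
  qed
  obtain S where S: "0 \<le> S" "M / 2 < measure \<nu>\<^sub>1 {0..S} + measure \<nu>\<^sub>2 {0..S}"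
    using mass_below[of "M / 2"] M_pos by auto
  \<comment> \<open>The time at which half the mass times the linear lower bound
    \<open>c * r\<close> reaches \<open>Z\<close>.\<close>
  define r where "r = 2 * Z / (M * c)"
  have r: "0 \<le> r" "M / 2 * (c * r) = Z" using Z0 c(1) M_pos by (auto simp: r_def)
  have "Z = M / 2 * (c * r)" using r by simp
  also have "\<dots> \<le> (measure \<nu>\<^sub>1 {0..S} + measure \<nu>\<^sub>2 {0..S}) * total x r"
    using S ge[OF r(1)] r(1) c(1) M_pos by (intro mult_mono) auto
  also have "\<dots> \<le> picard x (S + r)" using picard_total_ge[OF x S(1), of "S + r"] r(1) by simp
  also have "\<dots> < Z" using lt[of "S + r"] fixed_pos[of "S + r"] S(1) r(1) by simp
  finally show False by simp
qed

lemma total_at_top: "filterlim (total x) at_top at_top"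
proof -
  obtain C where C: "\<And>t. 0 \<le> t \<Longrightarrow> picard x t \<le> C + M * total x t"
    using picard_total_le[OF x] by blast
  show ?thesis
    unfolding filterlim_at_top
  proof
    fix Z
    have "eventually (\<lambda>t. C + M * Z \<le> x t) at_top"
      using solution_at_top by (auto simp: filterlim_at_top)
    moreover have "eventually (\<lambda>t::real. 0 \<le> t) at_top" by (rule eventually_ge_at_top)
    ultimately show "eventually (\<lambda>t. Z \<le> total x t) at_top"
    proof eventually_elim
      case (elim t)
      then have "M * Z \<le> M * total x t" using C[of t] fixed_pos[of t] by simp
      then show ?case using M_pos by simp
    qed
  qed
qed

text \<open>On \<open>[t - S, t]\<close> sublinearity gives
  \<open>f (x u) \<le> \<epsilon> * x u\<close>, monotonicity of \<open>x\<close> replaces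
  \<open>x u\<close> by \<open>x t\<close>, and \<open>x t\<close> is at most a multiple of
  \<open>total x t\<close>. The lost piece is thus a small fraction of the whole.\<close>

lemma total_shift:
  assumes sub: "((\<lambda>u. f u / u) \<longlongrightarrow> 0) at_top" and S: "0 \<le> S"
  shows "((\<lambda>t. total x (t - S) / total x t) \<longlongrightarrow> 1) at_top"
proof (rule tendstoI)
  fix e :: real assume "0 < e"
  \<comment> \<open>The window contributes \<open>S\<close>; the factor \<open>M + 1\<close> bounds
    \<open>x t / total x t\<close> once \<open>total x t\<close> exceeds the additive constant.
    \<open>S + 1\<close> gives strictness and allows \<open>S = 0\<close>.\<close>
  define \<epsilon> where "\<epsilon> = e / ((S + 1) * (M + 1))"
  have \<epsilon>: "0 < \<epsilon>" "S * \<epsilon> * (M + 1) < e"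
  proof -
    show "0 < \<epsilon>" using \<open>0 < e\<close> S M_pos by (simp add: \<epsilon>_def)
    then have "S * (\<epsilon> * (M + 1)) < (S + 1) * (\<epsilon> * (M + 1))"
      using M_pos by (intro mult_strict_right_mono) auto
    also have "\<dots> = e" using S M_pos by (simp add: \<epsilon>_def)
    finally show "S * \<epsilon> * (M + 1) < e" by (simp add: mult.assoc)
  qed
  obtain C where C: "\<And>t. 0 \<le> t \<Longrightarrow> picard x t \<le> C + M * total x t"
    using picard_total_le[OF x] by blast
  have "((\<lambda>t. f (x t) / x t) \<longlongrightarrow> 0) at_top"
    by (rule filterlim_compose[OF sub solution_at_top])
  then have "eventually (\<lambda>t. f (x t) / x t < \<epsilon>) at_top"
    by (rule order_tendstoD) (rule \<epsilon>)
  moreover have "eventually (\<lambda>t. 1 \<le> x t) at_top"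
    using solution_at_top by (auto simp: filterlim_at_top)
  moreover have "eventually (\<lambda>t::real. 0 \<le> t) at_top" by (rule eventually_ge_at_top)
  ultimately have "eventually (\<lambda>t. 0 \<le> t \<and> f (x t) \<le> \<epsilon> * x t) at_top"
    by eventually_elim (simp add: field_simps)
  then obtain T where T: "\<And>t. T \<le> t \<Longrightarrow> 0 \<le> t \<and> f (x t) \<le> \<epsilon> * x t"
    by (auto simp: eventually_at_top_linorder)
  have "eventually (\<lambda>t. max C 1 \<le> total x t) at_top"
    using total_at_top unfolding filterlim_at_top by blast
  moreover have "eventually (\<lambda>t. T + S \<le> t) at_top" by (rule eventually_ge_at_top)
  ultimately show "eventually (\<lambda>t. dist (total x (t - S) / total x t) 1 < e) at_top"
  proof eventually_elim
    case (elim t)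
    have t: "0 \<le> t - S" "0 \<le> t" "T \<le> t - S" using T[of "t - S"] elim S by auto
    have split: "total x t = total x (t - S) + integral {t - S..t} (\<lambda>u. f (x u))"
      unfolding total_def using t S tau_pos
      by (intro Henstock_Kurzweil_Integration.integral_combine[symmetric] f_comp_integrable[OF x]) auto
    have int: "(\<lambda>u. f (x u)) integrable_on {t - S..t}"
      using t tau_pos by (intro f_comp_integrable[OF x]) auto
    have "0 \<le> integral {t - S..t} (\<lambda>u. f (x u))"
    proof (rule Henstock_Kurzweil_Integration.integral_nonneg[OF int])
      fix u assume "u \<in> {t - S..t}"
      then have "0 \<le> x u" using x t tau_pos by (auto simp: admissible_def)
      then show "0 \<le> f (x u)" by (rule f_pos[THEN less_imp_le])
    qed
    moreover have "integral {t - S..t} (\<lambda>u. f (x u)) \<le> integral {t - S..t} (\<lambda>_. \<epsilon> * x t)"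
    proof (rule integral_le[OF int])
      fix u assume u: "u \<in> {t - S..t}"
      then have "T \<le> u" "0 \<le> u" "u \<le> t" using t by auto
      then have "f (x u) \<le> \<epsilon> * x u" using T[of u] by blast
      moreover have "\<epsilon> * x u \<le> \<epsilon> * x t"
        using solution_mono[OF \<open>0 \<le> u\<close> \<open>u \<le> t\<close>] \<epsilon>(1) by (simp add: mult_left_mono)
      ultimately show "f (x u) \<le> \<epsilon> * x t" by linarith
    qed auto
    moreover have "integral {t - S..t} (\<lambda>_. \<epsilon> * x t) = S * (\<epsilon> * x t)" using S by simp
    moreover have "S * (\<epsilon> * x t) \<le> S * (\<epsilon> * ((M + 1) * total x t))"
    proof -
      have "x t \<le> C + M * total x t" using C[OF t(2)] fixed_pos[OF t(2)] by simp
      also have "\<dots> \<le> (M + 1) * total x t" using elim by (simp add: algebra_simps)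
      finally show ?thesis using S \<epsilon>(1) by (intro mult_left_mono) auto
    qed
    moreover have "S * (\<epsilon> * ((M + 1) * total x t)) < e * total x t"
      using mult_strict_right_mono[OF \<epsilon>(2), of "total x t"] elim by (simp add: mult.assoc)
    ultimately have "\<bar>total x (t - S) - total x t\<bar> < e * total x t" using split by linarith
    moreover have "0 < total x t" using elim by simp
    ultimately have "\<bar>(total x (t - S) - total x t) / total x t\<bar> < e"
      by (simp add: abs_divide divide_less_eq)
    then show ?case using \<open>0 < total x t\<close> by (simp add: dist_real_def diff_divide_distrib)
  qed
qed

text \<open>From above, the additive constant is negligible against the divergent
  \<open>total\<close>. From below, a lag \<open>S\<close> with mass above \<open>a\<close> is
  chosen first, and only then does \<open>t\<close> grow, so the shift by \<open>S\<close>
  disappears in the limit.\<close>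

lemma solution_total_ratio:
  assumes sub: "((\<lambda>u. f u / u) \<longlongrightarrow> 0) at_top"
  shows "((\<lambda>t. x t / total x t) \<longlongrightarrow> M) at_top"
proof (rule order_tendstoI)
  have pos: "eventually (\<lambda>t. 0 < total x t) at_top"
    using total_at_top by (auto simp: filterlim_at_top_dense)
  {
    fix a assume a: "M < a"
    obtain C where C: "\<And>t. 0 \<le> t \<Longrightarrow> picard x t \<le> C + M * total x t"
      using picard_total_le[OF x] by blast
    have "((\<lambda>t. C / total x t) \<longlongrightarrow> 0) at_top"
      by (rule tendsto_divide_0[OF tendsto_const filterlim_at_top_imp_at_infinity[OF total_at_top]])
    then have "eventually (\<lambda>t. C / total x t < a - M) at_top"
      by (rule order_tendstoD) (use a in simp)
    moreover have "eventually (\<lambda>t::real. 0 \<le> t) at_top" by (rule eventually_ge_at_top)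
    ultimately show "eventually (\<lambda>t. x t / total x t < a) at_top" using pos
    proof eventually_elim
      case (elim t)
      then have "C < (a - M) * total x t" by (simp add: divide_less_eq)
      moreover have "x t \<le> C + M * total x t" using C[of t] fixed_pos[of t] elim by simp
      ultimately have "x t < a * total x t" by (simp add: algebra_simps)
      then show ?case using elim by (simp add: divide_less_eq)
    qed
  }
  {
    fix a assume "a < M"
    then obtain S where S: "0 \<le> S" "a < measure \<nu>\<^sub>1 {0..S} + measure \<nu>\<^sub>2 {0..S}"
      by (rule mass_below)
    define m where "m = measure \<nu>\<^sub>1 {0..S} + measure \<nu>\<^sub>2 {0..S}"
    have "((\<lambda>t. m * (total x (t - S) / total x t)) \<longlongrightarrow> m * 1) at_top"
      by (intro tendsto_mult tendsto_const total_shift sub S)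
    then have "eventually (\<lambda>t. a < m * (total x (t - S) / total x t)) at_top"
      by (rule order_tendstoD) (use S in \<open>simp add: m_def\<close>)
    moreover have "eventually (\<lambda>t. S \<le> t) at_top" by (rule eventually_ge_at_top)
    ultimately show "eventually (\<lambda>t. a < x t / total x t) at_top" using pos
    proof eventually_elim
      case (elim t)
      have "m * total x (t - S) \<le> x t"
        using picard_total_ge[OF x S(1), of t] fixed_pos[of t] elim S(1) by (simp add: m_def)
      then have "m * (total x (t - S) / total x t) \<le> x t / total x t"
        using elim by (simp add: divide_right_mono)
      then show ?case using elim by linarith
    qed
  }
qed

theorem solution_asymptotics:
  assumes rv: "regularly_varying f \<beta>" and "\<beta> < 1"
  shows "((\<lambda>t. x t / recip_primitive_inv f (M * t)) \<longlongrightarrow> 1) at_top"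
proof -
  \<comment> \<open>\<open>J\<close> is used in place of \<open>x\<close> because its derivative
    \<open>M * f (x t)\<close> contains no delayed values.\<close>
  define J where "J t = M * total x t" for t
  have J: "filterlim J at_top at_top"
    unfolding J_def by (rule filterlim_tendsto_pos_mult_at_top[OF tendsto_const M_pos total_at_top])
  have evJ: "eventually (\<lambda>t. 0 < J t) at_top" using J by (auto simp: filterlim_at_top_dense)
  have "((\<lambda>t. x t / total x t / M) \<longlongrightarrow> M / M) at_top"
    by (intro tendsto_divide tendsto_const solution_total_ratio regularly_varying_sublinear[OF f_cont rv \<open>\<beta> < 1\<close>])
       (use M_pos in simp)
  then have xJ: "((\<lambda>t. x t / J t) \<longlongrightarrow> 1) at_top" using M_pos by (simp add: J_def mult.commute)
  have fJ: "((\<lambda>t. f (x t) / f (J t)) \<longlongrightarrow> 1) at_top"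
    by (rule regularly_varying_asymp_cong[OF f_cont rv J xJ])
  have "((\<lambda>t. recip_primitive f (J t) / (M * t)) \<longlongrightarrow> 1) at_top"
  proof (rule lhospital_at_top_at_top)
    show "filterlim (\<lambda>t. M * t) at_top at_top"
      by (rule filterlim_tendsto_pos_mult_at_top[OF tendsto_const M_pos filterlim_ident])
    show "eventually (\<lambda>t::real. M \<noteq> 0) at_top" using M_pos by simp
    show "eventually (\<lambda>t. ((\<lambda>t. M * t) has_real_derivative M) (at t)) at_top"
      by (auto intro!: derivative_eq_intros)
    show "eventually (\<lambda>t. ((\<lambda>t. recip_primitive f (J t)) has_real_derivative 1 / f (J t) * (M * f (x t))) (at t)) at_top"
      using evJ eventually_gt_at_top[of 0]
    proof eventually_elim
      case (elim t)
      have "(J has_real_derivative M * f (x t)) (at t)"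
        unfolding J_def[abs_def] by (rule DERIV_cmult[OF total_deriv]) (use elim in simp)
      then show ?case
        using elim by (intro DERIV_chain2[where f = "recip_primitive f"] recip_primitive_deriv[OF f_cont f_pos]) auto
    qed
    show "((\<lambda>t. 1 / f (J t) * (M * f (x t)) / M) \<longlongrightarrow> 1) at_top"
      using fJ M_pos by simp
  qed
  moreover have "eventually (\<lambda>t. recip_primitive f (J t) / (M * t) =
      recip_primitive f (J t) / recip_primitive f (recip_primitive_inv f (M * t))) at_top"
    using eventually_gt_at_top[of 0]
  proof eventually_elim
    case (elim t)
    then show ?case using recip_primitive_inv(2)[OF f_cont rv \<open>\<beta> < 1\<close>, of "M * t"] M_pos by simp
  qed
  ultimately have "((\<lambda>t. recip_primitive f (J t) / recip_primitive f (recip_primitive_inv f (M * t))) \<longlongrightarrow> 1) at_top"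
    by (rule Lim_transform_eventually)
  moreover have "filterlim (\<lambda>t. recip_primitive_inv f (M * t)) at_top at_top"
    by (rule filterlim_compose[OF recip_primitive_inv_at_top[OF f_cont rv \<open>\<beta> < 1\<close>]
          filterlim_tendsto_pos_mult_at_top[OF tendsto_const M_pos filterlim_ident]])
  ultimately have "((\<lambda>t. J t / recip_primitive_inv f (M * t)) \<longlongrightarrow> 1) at_top"
    by (intro recip_primitive_asymp_inj[OF f_cont rv \<open>\<beta> < 1\<close>, where a = J and b = "\<lambda>t. recip_primitive_inv f (M * t)"] evJ)
  with xJ have "((\<lambda>t. x t / J t * (J t / recip_primitive_inv f (M * t))) \<longlongrightarrow> 1 * 1) at_top"
    by (rule tendsto_mult)
  moreover have "eventually (\<lambda>t. x t / J t * (J t / recip_primitive_inv f (M * t)) = x t / recip_primitive_inv f (M * t)) at_top"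
    using evJ by eventually_elim simp
  ultimately have "((\<lambda>t. x t / recip_primitive_inv f (M * t)) \<longlongrightarrow> 1 * 1) at_top"
    by (rule Lim_transform_eventually)
  then show ?thesis by simp
qed

end
end

theorem theorem9:
  fixes \<tau> M \<beta> :: real and \<mu>\<^sub>1 \<mu>\<^sub>2 :: "real measure" and f \<psi> :: "real \<Rightarrow> real"
  assumes "0 < \<tau>"
    and "sets \<mu>\<^sub>1 = sets (restrict_space borel {0..})"
    and "sets \<mu>\<^sub>2 = sets (restrict_space borel {0..})"
    and "emeasure \<mu>\<^sub>1 {0..\<tau>} + emeasure \<mu>\<^sub>2 {0..} = ennreal M" and "0 < M"
    and "continuous_on {0..} f" and "\<forall>x\<ge>0. 0 < f x"
    and "locally_lipschitz_on {0..} f"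
    and "regularly_varying f \<beta>" and "\<beta> < 1" and "\<beta> \<noteq> 0"
    and "continuous_on {-\<tau>..0} \<psi>" and "\<forall>t\<in>{-\<tau>..0}. 0 < \<psi> t"
  shows "\<exists>x. is_solution \<tau> \<mu>\<^sub>1 \<mu>\<^sub>2 f \<psi> x \<and>
             (\<forall>y. is_solution \<tau> \<mu>\<^sub>1 \<mu>\<^sub>2 f \<psi> y \<longrightarrow> (\<forall>t\<ge>-\<tau>. y t = x t)) \<and>
             filterlim x at_top at_top \<and>
             ((\<lambda>t. x t / recip_primitive_inv f (M * t)) \<longlongrightarrow> 1) at_top"
proof -
  \<comment> \<open>Mass of \<open>\<mu>\<^sub>1\<close> beyond \<open>\<tau>\<close> is not assumed
    finite, so it is removed before passing to the line.\<close>
  define \<nu>\<^sub>1 where "\<nu>\<^sub>1 = distr (restrict_space \<mu>\<^sub>1 {0..\<tau>}) borel (\<lambda>s. s)"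
  define \<nu>\<^sub>2 where "\<nu>\<^sub>2 = distr (restrict_space \<mu>\<^sub>2 {0..}) borel (\<lambda>s. s)"
  have A: "{0..\<tau>} \<in> sets \<mu>\<^sub>1" "{0..} \<in> sets \<mu>\<^sub>2"
    by (auto simp: assms(2,3) sets_restrict_space_iff)
  have "emeasure \<mu>\<^sub>1 {0..\<tau>} + emeasure \<mu>\<^sub>2 {0..} < \<infinity>" by (simp add: assms(4))
  then have fin: "emeasure \<mu>\<^sub>1 {0..\<tau>} < \<infinity>" "emeasure \<mu>\<^sub>2 {0..} < \<infinity>"
    by (auto simp: less_top[symmetric])
  note n1 = delay_measure_distr[OF assms(2) A(1) fin(1), folded \<nu>\<^sub>1_def]
  note n2 = delay_measure_distr[OF assms(3) A(2) fin(2), folded \<nu>\<^sub>2_def]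
  interpret N1: delay_measure \<nu>\<^sub>1 by (rule n1)
  interpret N2: delay_measure \<nu>\<^sub>2 by (rule n2)
  have "ennreal (N1.mass + N2.mass) = ennreal M"
    using n1(2) n2(2) assms(4) by (simp add: N1.emeasure_eq_measure N2.emeasure_eq_measure ennreal_plus)
  then have mass: "N1.mass + N2.mass = M" using \<open>0 < M\<close> by (subst (asm) ennreal_inj) auto
  interpret E: delay_equation \<nu>\<^sub>1 \<nu>\<^sub>2 \<tau> f \<psi>
  proof
    show "\<exists>L. L-lipschitz_on {0..R} f" for R
      by (rule locally_lipschitz_on_compact_subset[OF assms(8)]) (use assms(6) in auto)
    show "\<exists>K>0. \<forall>u\<ge>0. f u \<le> K * (1 + u)"
      by (rule regularly_varying_linear_growth[OF assms(6,9,10)])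
    show "0 < N1.mass + N2.mass" using mass assms(5) by simp
  qed (use assms in auto)
  have Meq: "E.M = M" using mass by (simp add: E.M_def)
  have rhs_eq: "E.rhs x t = (LINT s:{0..\<tau>}|\<mu>\<^sub>1. f (x (t - s))) + (LINT s:{0..t}|\<mu>\<^sub>2. f (x (t - s)))"
    if x: "E.admissible x" and t: "0 < t" for x t
  proof -
    have [measurable]: "cut (-\<tau>) (\<lambda>u. f (x u)) \<in> borel_measurable borel"
      "cut 0 (\<lambda>u. f (x u)) \<in> borel_measurable borel"
      by (intro E.cut_borel x E.tau0)+
    have "N1.conv (cut (-\<tau>) (\<lambda>u. f (x u))) t = (LINT s:{0..\<tau>}|\<mu>\<^sub>1. cut (-\<tau>) (\<lambda>u. f (x u)) (t - s))"
      unfolding N1.conv_def by (rule n1(3)) measurable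
    also have "\<dots> = (LINT s:{0..\<tau>}|\<mu>\<^sub>1. f (x (t - s)))"
      unfolding set_lebesgue_integral_def
      by (rule Bochner_Integration.integral_cong) (use t in \<open>auto simp: cut_def indicator_def\<close>)
    finally have 1: "N1.conv (cut (-\<tau>) (\<lambda>u. f (x u))) t = \<dots>" .
    have "N2.conv (cut 0 (\<lambda>u. f (x u))) t = (LINT s:{0..}|\<mu>\<^sub>2. cut 0 (\<lambda>u. f (x u)) (t - s))"
      unfolding N2.conv_def by (rule n2(3)) measurable
    \<comment> \<open>Here the cut does real work: it is nonzero only for \<open>s \<le> t\<close>
      and so shortens the range of integration from \<open>{0..}\<close> to
      \<open>{0..t}\<close>.\<close>
    also have "\<dots> = (LINT s:{0..t}|\<mu>\<^sub>2. f (x (t - s)))"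
      unfolding set_lebesgue_integral_def
      by (rule Bochner_Integration.integral_cong) (auto simp: cut_def indicator_def)
    finally show ?thesis by (simp add: E.rhs_def 1)
  qed
  have iff: "is_solution \<tau> \<mu>\<^sub>1 \<mu>\<^sub>2 f \<psi> z \<longleftrightarrow> E.admissible z \<and> (\<forall>t\<ge>-\<tau>. z t = E.picard z t)" for z
    by (rule E.is_solution_iff) (rule rhs_eq)
  obtain x where x: "E.admissible x" "\<And>t. -\<tau> \<le> t \<Longrightarrow> x t = E.picard x t"
    using E.picard_fixed_exists by blast
  show ?thesis
  proof (intro exI[of _ x] conjI allI impI)
    show "is_solution \<tau> \<mu>\<^sub>1 \<mu>\<^sub>2 f \<psi> x" unfolding iff using x by blast
    show "y t = x t" if "is_solution \<tau> \<mu>\<^sub>1 \<mu>\<^sub>2 f \<psi> y" "-\<tau> \<le> t" for y t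
    proof -
      from that(1) have y: "E.admissible y" "\<And>t. -\<tau> \<le> t \<Longrightarrow> y t = E.picard y t"
        unfolding iff by blast+
      show ?thesis by (rule E.picard_fixed_unique[OF y x that(2)])
    qed
    show "filterlim x at_top at_top" by (rule E.solution_at_top[OF x])
    show "((\<lambda>t. x t / recip_primitive_inv f (M * t)) \<longlongrightarrow> 1) at_top"
      using E.solution_asymptotics[OF x assms(9,10)] by (simp add: Meq)
  qed
qed

end
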